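(* Let $n\geq 3$. The augmented cube $AQ_n$ contains $m$ pairwise edge-disjoint Hamiltonian cycles, where $m=n-1$ if $n$ is odd and $m=n-2$ if $n$ is even.
   Context: The augmented cube $AQ_n$ has vertex set $\{0,1\}^n$ (strings $u_n\cdots u_1$), and $u,v$ are adjacent iff either they differ in exactly one bit position, or there is $j\in\{2,\dots,n\}$ such that $v_l\neq u_l$ for all $l\leq j$ and $v_l=u_l$ for all $l>j$. It is $(2n-1)$-regular. Hamiltonian cycles are edge-disjoint if no two share an edge. *)

theory Defs
  imports "Graph_Theory.Graph_Theory"
begin

text \<open>
  A vertex \<open>u\<^sub>n \<cdots> u\<^sub>1\<close> is the list \<open>[u\<^sub>n, \<dots>, u\<^sub>1]\<close>, in the written order, so that the
  bit in position \<open>l\<close> (counted from 1, from the right) is entry \<open>n - l\<close> of the list.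
\<close>

definition bit_at :: "bool list \<Rightarrow> nat \<Rightarrow> bool" where
  "bit_at u l = u ! (length u - l)"

definition aq_adj :: "nat \<Rightarrow> bool list \<Rightarrow> bool list \<Rightarrow> bool" where
  "aq_adj n u v \<longleftrightarrow>
     (\<exists>!i. i \<in> {1..n} \<and> bit_at u i \<noteq> bit_at v i) \<or>
     (\<exists>j\<in>{2..n}. (\<forall>l\<in>{1..j}. bit_at v l \<noteq> bit_at u l) \<and>
                 (\<forall>l\<in>{j<..n}. bit_at v l = bit_at u l))"

text \<open>Each undirected edge is represented by its two opposite arcs.\<close>

definition augmented_cube :: "nat \<Rightarrow> bool list pair_pre_digraph" where
  "augmented_cube n =
     \<lparr> pverts = {u. length u = n},
       parcs = {(u, v). length u = n \<and> length v = n \<and> aq_adj n u v} \<rparr>"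

text \<open>
  The length bound excludes the closed walk \<open>u, v, u\<close> along a single edge, which is a cycle
  of the symmetric digraph but not of the undirected graph. On a closed walk, the tails of
  the arcs are exactly the visited vertices.
\<close>

definition hamiltonian_cycle :: "'a pair_pre_digraph \<Rightarrow> ('a \<times> 'a) awalk \<Rightarrow> bool" where
  "hamiltonian_cycle G p \<longleftrightarrow>
     pre_digraph.cycle (with_proj G) p \<and> 3 \<le> length p \<and> fst ` set p = pverts G"

definition undirected_edges :: "('a \<times> 'a) awalk \<Rightarrow> 'a set set" where
  "undirected_edges p = (\<lambda>(u, v). {u, v}) ` set p"

definition edge_disjoint :: "('a \<times> 'a) awalk \<Rightarrow> ('a \<times> 'a) awalk \<Rightarrow> bool" where
  "edge_disjoint p q \<longleftrightarrow> undirected_edges p \<inter> undirected_edges q = {}"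

lemma aq_adj_sym: "aq_adj n u v \<longleftrightarrow> aq_adj n v u"
  unfolding aq_adj_def by (simp only: eq_commute[of "bit_at u a" "bit_at v b" for a b])

lemma aq_adj_irrefl: "\<not> aq_adj n u u"
  by (auto simp: aq_adj_def)

lemma pair_graph_augmented_cube: "pair_graph (augmented_cube n)"
proof -
  have fin: "finite {u :: bool list. length u = n}"
    using finite_lists_length_eq[of "UNIV :: bool set" n] by simp
  have fin_arcs: "finite (parcs (augmented_cube n))"
    by (rule finite_subset[OF _ finite_cartesian_product[OF fin fin]])
      (auto simp: augmented_cube_def)
  have sym_arcs: "symmetric (with_proj (augmented_cube n))"
    unfolding symmetric_def with_proj_simps
    by (rule symI) (simp add: augmented_cube_def aq_adj_sym[of n])
  show ?thesis
  proof unfold_locales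
    fix e assume "e \<in> parcs (augmented_cube n)"
    then obtain u v where "e = (u, v)" "length u = n" "length v = n" "aq_adj n u v"
      unfolding augmented_cube_def by auto
    then show "fst e \<in> pverts (augmented_cube n)" "snd e \<in> pverts (augmented_cube n)"
      "fst e \<noteq> snd e"
      using aq_adj_irrefl by (simp_all add: augmented_cube_def) metis
  next
    show "finite (pverts (augmented_cube n))"
      using fin by (simp add: augmented_cube_def)
  next
    show "finite (parcs (augmented_cube n))" by (rule fin_arcs)
  next
    show "symmetric (with_proj (augmented_cube n))" by (rule sym_arcs)
  qed
qed

end

theory Submission
  imports Defs
begin

text \<open>
  Let \<open>c\<close> complement all bits of a string. After a linear change of coordinates \<open>AQ\<^sub>n\<^sub>+\<^sub>2\<close>
  consists of four copies of \<open>AQ\<^sub>n\<close>, the rows \<open>(s1, s2)\<close>: the vertex \<open>(y, s1, s2)\<close> is also joined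
  to \<open>y\<close> in each of the three other rows and to \<open>(c y, \<not> s1, s2)\<close>, and complementing all bits becomes
  \<open>(y, s1, s2) \<mapsto> (y, s1, \<not> s2)\<close>. For odd \<open>n\<close> we go from \<open>n\<close> to \<open>n + 2\<close>, gaining two cycles.

  Let \<open>C1\<close> and \<open>C2\<close> be two of the cycles of \<open>AQ\<^sub>n\<close> that have the form \<open>l @ map c l\<close>. Moving along
  \<open>C1\<close> and changing the row at every vertex, the rows of \<open>C1\<close> and the new edges that change \<open>s1\<close>
  split into two Hamiltonian cycles, again of the form \<open>l @ map c l\<close>; in the same way the rows of
  \<open>C2\<close> and the remaining new edges split into two Hamiltonian cycles. The four copies of any other
  cycle are joined into one: an edge \<open>{p, r}\<close> of it is deleted in all rows, and two new edges are
  inserted at \<open>p\<close> and two at \<open>r\<close>. These new edges are taken from the cycles built on \<open>C1\<close>, the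
  first of which receives the deleted edges. If this is done for two cycles at once, with edges
  \<open>{p, r}\<close> and \<open>{q, t}\<close> that are crossing chords \<open>p < q < r < t\<close> of \<open>C1\<close> spanning odd distances, the three
  segments between \<open>p\<close>, \<open>q\<close>, \<open>r\<close>, \<open>t\<close> are merely permuted and the cycle survives. Such chords can be
  kept available, in disjoint intervals of \<open>C1\<close>, throughout the induction: the half of \<open>C1\<close> that
  is not modified reproduces the chords of the old pairs, and chords of \<open>C1\<close> in \<open>C2\<close> provide those of
  the new pair.

  For even \<open>n\<close> the two copies of each cycle of \<open>AQ\<^sub>n\<^sub>-\<^sub>1\<close> are joined through one of its edges, the
  chosen edges being pairwise disjoint.
\<close>

section \<open>Cyclic lists\<close>

definition cyc_arcs :: "'a list \<Rightarrow> ('a \<times> 'a) set" where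
  "cyc_arcs xs = set (zip xs (rotate1 xs))"

definition cyc_edges :: "'a list \<Rightarrow> 'a set set" where
  "cyc_edges xs = (\<lambda>(u, v). {u, v}) ` cyc_arcs xs"

definition ham_list :: "'a set \<Rightarrow> ('a \<Rightarrow> 'a \<Rightarrow> bool) \<Rightarrow> 'a list \<Rightarrow> bool" where
  "ham_list V R xs \<longleftrightarrow> distinct xs \<and> set xs = V \<and> (\<forall>(u, v)\<in>cyc_arcs xs. R u v)"

lemma path_arcs_iff:
  "(u, v) \<in> set (zip (x # ys) (ys @ [z])) \<longleftrightarrow> (\<exists>l1 l2. x # ys @ [z] = l1 @ u # v # l2)"
proof (induction ys arbitrary: x)
  case Nil
  show ?case by (auto simp: Cons_eq_append_conv)
next
  case (Cons y ys)
  have "(\<exists>l1 l2. x # (y # ys) @ [z] = l1 @ u # v # l2) \<longleftrightarrow>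
      (u = x \<and> v = y) \<or> (\<exists>l1 l2. y # ys @ [z] = l1 @ u # v # l2)"
    (is "?l = ?r")
  proof
    assume ?l
    then obtain l1 l2 where l: "x # (y # ys) @ [z] = l1 @ u # v # l2" by blast
    then show ?r by (cases l1) auto
  next
    assume ?r
    then show ?l
    proof
      assume "u = x \<and> v = y"
      then show ?l by (intro exI[of _ "[]"] exI[of _ "ys @ [z]"]) simp
    next
      assume "\<exists>l1 l2. y # ys @ [z] = l1 @ u # v # l2"
      then obtain l1 l2 where "y # ys @ [z] = l1 @ u # v # l2" by blast
      then show ?l by (intro exI[of _ "x # l1"] exI[of _ l2]) simp
    qed
  qed
  then show ?case using Cons.IH[of y] by simp
qed

lemma cyc_arcs_Cons: "cyc_arcs (x # ys) = set (zip (x # ys) (ys @ [x]))"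
  by (simp add: cyc_arcs_def)

text \<open>Appending the head opens the cycle into a walk, so that arcs become infixes and
  \<open>successively\<close> applies.\<close>

lemma cyc_arcs_iff:
  assumes "xs \<noteq> []"
  shows "(u, v) \<in> cyc_arcs xs \<longleftrightarrow> (\<exists>l1 l2. xs @ [hd xs] = l1 @ u # v # l2)"
  using assms path_arcs_iff[of u v "hd xs" "tl xs" "hd xs"]
  by (cases xs) (simp_all add: cyc_arcs_Cons)

lemma successively_iff_infix:
  "successively P xs \<longleftrightarrow> (\<forall>l1 u v l2. xs = l1 @ u # v # l2 \<longrightarrow> P u v)"
proof (induction xs rule: induct_list012)
  case (3 x y zs)
  show ?case
  proof
    assume "successively P (x # y # zs)"
    then have "P x y" "\<forall>l1 u v l2. y # zs = l1 @ u # v # l2 \<longrightarrow> P u v"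
      using "3.IH"(2) by auto
    then show "\<forall>l1 u v l2. x # y # zs = l1 @ u # v # l2 \<longrightarrow> P u v"
      by (metis (no_types, lifting) append_Cons append_Nil list.exhaust list.inject)
  next
    assume a: "\<forall>l1 u v l2. x # y # zs = l1 @ u # v # l2 \<longrightarrow> P u v"
    have "P x y" using a by force
    moreover have "\<forall>l1 u v l2. y # zs = l1 @ u # v # l2 \<longrightarrow> P u v"
    proof (intro allI impI)
      fix l1 u v l2
      assume "y # zs = l1 @ u # v # l2"
      then have "x # y # zs = (x # l1) @ u # v # l2" by simp
      then show "P u v" using a by blast
    qed
    ultimately show "successively P (x # y # zs)" using "3.IH"(2) by simp
  qed
qed (auto simp: Cons_eq_append_conv)

lemma cyc_arcs_all_iff:
  "xs \<noteq> [] \<Longrightarrow> (\<forall>(u, v)\<in>cyc_arcs xs. P u v) \<longleftrightarrow> successively P (xs @ [hd xs])"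
  unfolding successively_iff_infix using cyc_arcs_iff[of xs] by fast

lemma cyc_arcs_setD: "(u, v) \<in> cyc_arcs xs \<Longrightarrow> u \<in> set xs \<and> v \<in> set xs"
  unfolding cyc_arcs_def by (auto dest: set_zip_leftD set_zip_rightD)

lemma cyc_arcs_nth:
  "cyc_arcs xs = {(xs ! i, xs ! (Suc i mod length xs)) | i. i < length xs}"
proof -
  have "zip xs (rotate1 xs) ! i = (xs ! i, xs ! (Suc i mod length xs))" if "i < length xs" for i
    using that by (simp add: nth_rotate1)
  then show ?thesis
    unfolding cyc_arcs_def set_conv_nth by (auto simp del: nth_zip) metis+
qed

lemma cyc_arcs_out:
  assumes "u \<in> set xs" obtains v where "(u, v) \<in> cyc_arcs xs"
  using assms unfolding cyc_arcs_nth by (auto simp: in_set_conv_nth)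

lemma cyc_arcs_inj:
  assumes "distinct xs" "(u, v) \<in> cyc_arcs xs" "(u, w) \<in> cyc_arcs xs" shows "v = w"
  using assms unfolding cyc_arcs_nth by (auto simp: nth_eq_iff_index_eq)

lemma cyc_arcs_asym:
  assumes "distinct xs" "3 \<le> length xs" "(u, v) \<in> cyc_arcs xs" shows "(v, u) \<notin> cyc_arcs xs"
proof
  assume "(v, u) \<in> cyc_arcs xs"
  then obtain i j where ij: "i < length xs" "u = xs ! i" "v = xs ! (Suc i mod length xs)"
    "j < length xs" "v = xs ! j" "u = xs ! (Suc j mod length xs)"
    using assms(3) unfolding cyc_arcs_nth by blast
  then have "xs ! j = xs ! (Suc i mod length xs)" "xs ! i = xs ! (Suc j mod length xs)"
    "Suc i mod length xs < length xs" "Suc j mod length xs < length xs"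
    using assms(2) ij by (metis, metis, simp_all add: less_imp_le mod_less_divisor[OF less_le_trans[of 0 3]])
  then have "j = Suc i mod length xs" "i = Suc j mod length xs"
    using assms(1) ij(1,4) by (simp_all add: nth_eq_iff_index_eq)
  \<comment> \<open>Two steps forward would lead back to index \<open>i\<close>, which is impossible
    modulo a length of at least 3.\<close>
  then show False using assms(2) ij(1,4) by (auto simp: mod_Suc split: if_splits)
qed

lemma cyc_arcs_irrefl:
  assumes "distinct xs" "2 \<le> length xs" shows "(u, u) \<notin> cyc_arcs xs"
proof
  assume "(u, u) \<in> cyc_arcs xs"
  then obtain i where ij: "i < length xs" "xs ! i = xs ! (Suc i mod length xs)"
    unfolding cyc_arcs_nth by blast
  moreover have "Suc i mod length xs < length xs" using assms(2) by (intro mod_less_divisor) (cases xs, simp_all)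
  ultimately have "i = Suc i mod length xs" using assms(1) by (simp add: nth_eq_iff_index_eq)
  then show False using assms(2) ij(1) by (auto simp: mod_Suc split: if_splits)
qed

lemma cyc_edges_iff: "{u, v} \<in> cyc_edges xs \<longleftrightarrow> (u, v) \<in> cyc_arcs xs \<or> (v, u) \<in> cyc_arcs xs"
  unfolding cyc_edges_def by (auto simp: doubleton_eq_iff)

lemma cyc_edges_disjointI:
  assumes "\<forall>(u, v)\<in>cyc_arcs xs. P u v" "\<forall>(u, v)\<in>cyc_arcs ys. Q u v"
    and "\<And>u v. P u v \<Longrightarrow> \<not> Q u v \<and> \<not> Q v u"
  shows "cyc_edges xs \<inter> cyc_edges ys = {}"
  using assms unfolding cyc_edges_def by (fastforce simp: doubleton_eq_iff)

lemma cyc_arcs_rotate1: "cyc_arcs (rotate1 xs) = cyc_arcs xs"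
proof (cases xs)
  case (Cons x ys)
  have "zip (a # zs @ [x]) (zs @ [x, a]) = zip (a # zs) (zs @ [x]) @ [(x, a)]" for a and zs :: "'a list"
    using zip_append[of "a # zs" "zs @ [x]" "[x]" "[a]"] by simp
  with Cons show ?thesis by (cases ys) (simp_all add: cyc_arcs_def)
qed simp

lemma cyc_arcs_rotate [simp]: "cyc_arcs (rotate k xs) = cyc_arcs xs"
  by (induction k) (auto simp: cyc_arcs_rotate1)

lemma cyc_arcs_rev: "cyc_arcs (rev xs) = (cyc_arcs xs)\<inverse>"
proof (cases xs)
  case (Cons x ys)
  have "cyc_arcs (rev xs) = cyc_arcs (x # rev ys)"
    using cyc_arcs_rotate1[of "x # rev ys"] Cons by simp
  moreover have "(u, v) \<in> cyc_arcs (x # rev ys) \<longleftrightarrow> (v, u) \<in> cyc_arcs (x # ys)" for u v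
  proof -
    have "(\<exists>l1 l2. x # rev ys @ [x] = l1 @ u # v # l2) \<longleftrightarrow>
      (\<exists>l1 l2. rev (x # rev ys @ [x]) = rev (l1 @ u # v # l2))"
      by (simp only: rev_is_rev_conv)
    also have "\<dots> \<longleftrightarrow> (\<exists>l1 l2. x # ys @ [x] = l1 @ v # u # l2)"
      by simp (metis rev_rev_ident)
    finally show ?thesis by (simp add: cyc_arcs_iff)
  qed
  ultimately show ?thesis using Cons by auto
qed (simp add: cyc_arcs_def)

lemma cyc_edges_rev: "cyc_edges (rev xs) = cyc_edges xs"
  unfolding cyc_edges_def cyc_arcs_rev by (auto simp: insert_commute image_iff) 

text \<open>The cycle is cut open at this edge: after a reversal, if it is traversed from
  \<open>p\<close> to \<open>r\<close>, a rotation makes the arc from \<open>r\<close> to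
  \<open>p\<close> the closing one.\<close>

lemma cyc_path_between:
  assumes "distinct xs" "{p, r} \<in> cyc_edges xs"
  obtains ys where "distinct ys" "set ys = set xs" "cyc_edges ys = cyc_edges xs"
    "hd ys = p" "last ys = r" "length ys = length xs"
proof -
  note goal = that
  have *: thesis if "(r, p) \<in> cyc_arcs zs" "distinct zs" "set zs = set xs"
    "cyc_edges zs = cyc_edges xs" "length zs = length xs" for zs
  proof -
    obtain i where i: "i < length zs" "r = zs ! i" "p = zs ! (Suc i mod length zs)"
      using \<open>(r, p) \<in> cyc_arcs zs\<close> unfolding cyc_arcs_nth by blast
    let ?ys = "rotate (Suc i) zs"
    have ne: "zs \<noteq> []" using i(1) by auto
    have "hd ?ys = p" unfolding i(3) by (rule hd_rotate_conv_nth[OF ne])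
    moreover have "last ?ys = r"
    proof -
      have "last ?ys = ?ys ! (length zs - 1)" using ne by (simp add: last_conv_nth)
      also have "\<dots> = zs ! ((Suc i + (length zs - 1)) mod length zs)"
        using ne by (intro nth_rotate) simp
      also have "Suc i + (length zs - 1) = i + length zs" using ne by (cases zs) auto
      finally show ?thesis using i by simp
    qed
    ultimately show thesis
      using that(2-) by (intro goal[of ?ys]) (simp_all add: cyc_edges_def cyc_arcs_rotate1)
  qed
  show thesis
  proof (cases "(r, p) \<in> cyc_arcs xs")
    case True
    then show ?thesis using * assms(1) by blast
  next
    case False
    then have "(r, p) \<in> cyc_arcs (rev xs)"
      using assms(2) by (simp add: cyc_edges_iff cyc_arcs_rev)
    then show ?thesis using *[of "rev xs"] assms(1) by (simp add: cyc_edges_rev)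
  qed
qed

lemma cyc_arcs_map: "cyc_arcs (map f xs) = (\<lambda>(u, v). (f u, f v)) ` cyc_arcs xs"
  by (simp add: cyc_arcs_def rotate1_map zip_map_map)

text \<open>A walk from \<open>hd M\<close> to \<open>f (hd M)\<close> is continued by its own image
  under \<open>f\<close>, which leads back to \<open>hd M\<close>.\<close>

lemma half_cycle:
  assumes "M \<noteq> []" "successively P (M @ [f (hd M)])" "\<And>u v. P u v \<Longrightarrow> P (f u) (f v)"
    and "f (f (hd M)) = hd M"
  shows "\<forall>(u, v)\<in>cyc_arcs (M @ map f M). P u v"
proof -
  have "successively P (map f (M @ [f (hd M)]))"
    using assms(2) by (subst successively_map) (erule successively_mono, simp_all add: assms(3))
  with assms(1,2,4) have "successively P ((M @ map f M) @ [hd (M @ map f M)])"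
    by (simp add: successively_append_iff hd_map)
  then show ?thesis using assms(1) cyc_arcs_all_iff[of "M @ map f M"] by simp
qed

lemma infix_cyc_arcs: "(u, v) \<in> cyc_arcs (l1 @ u # v # l2)"
proof -
  have "(u, v) \<in> cyc_arcs (l1 @ u # v # l2) \<longleftrightarrow>
      (\<exists>k1 k2. (l1 @ u # v # l2) @ [hd (l1 @ u # v # l2)] = k1 @ u # v # k2)"
    by (rule cyc_arcs_iff) simp
  then show ?thesis by auto
qed

section \<open>Four stacked copies of a graph\<close>

fun stack_adj :: "('a \<Rightarrow> 'a \<Rightarrow> bool) \<Rightarrow> ('a \<Rightarrow> 'a) \<Rightarrow>
    'a \<times> bool \<times> bool \<Rightarrow> 'a \<times> bool \<times> bool \<Rightarrow> bool" where
  "stack_adj R c (y, s1, s2) (y', s1', s2') \<longleftrightarrow>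
     (R y y' \<and> s1' = s1 \<and> s2' = s2) \<or> (y' = y \<and> (s1', s2') \<noteq> (s1, s2)) \<or>
     (y' = c y \<and> s1' \<noteq> s1 \<and> s2' = s2)"

fun flip2 :: "'a \<times> bool \<times> bool \<Rightarrow> 'a \<times> bool \<times> bool" where
  "flip2 (y, s1, s2) = (y, s1, \<not> s2)"

lemma flip2_flip2 [simp]: "flip2 (flip2 u) = u"
  by (cases u) simp

text \<open>\<open>M\<close> meets each column with each value of \<open>s1\<close> exactly once,
  with some \<open>s2\<close>; the image under \<open>flip2\<close> supplies precisely the missing
  value of \<open>s2\<close>.\<close>

lemma double_cover:
  assumes "distinct (map (\<lambda>(y, a, b). (y, a)) M)" "set (map (\<lambda>(y, a, b). (y, a)) M) = V \<times> UNIV"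
  shows "distinct (M @ map flip2 M)" "set (M @ map flip2 M) = V \<times> UNIV"
proof -
  have inj: "inj_on (\<lambda>(y, a, b). (y, a)) (set M)" using assms(1) by (simp add: distinct_map)
  have "inj_on flip2 (set M)" by (metis flip2_flip2 inj_onI)
  moreover have "distinct M" using assms(1) by (simp add: distinct_map)
  moreover have "set M \<inter> flip2 ` set M = {}"
  proof (rule ccontr)
    assume "set M \<inter> flip2 ` set M \<noteq> {}"
    then obtain y a b where "(y, a, b) \<in> set M" "(y, a, \<not> b) \<in> set M"
      by (auto simp: image_iff) (metis flip2.simps)+
    then show False using inj_onD[OF inj, of "(y, a, b)" "(y, a, \<not> b)"] by simp
  qed
  ultimately show "distinct (M @ map flip2 M)"
    by (simp add: distinct_map)
  show "set (M @ map flip2 M) = V \<times> UNIV"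
  proof
    have M: "y \<in> V" if "(y, a, b) \<in> set M" for y a b
    proof -
      have "(y, a) \<in> set (map (\<lambda>(y, a, b). (y, a)) M)" using that by force
      then show ?thesis unfolding assms(2) by simp
    qed
    then show "set (M @ map flip2 M) \<subseteq> V \<times> UNIV" by auto
  next
    show "V \<times> UNIV \<subseteq> set (M @ map flip2 M)"
    proof
      fix u assume "u \<in> V \<times> (UNIV :: (bool \<times> bool) set)"
      then obtain y a b where u: "u = (y, a, b)" "y \<in> V" by auto
      then have "(y, a) \<in> (\<lambda>(y, a, b). (y, a)) ` set M" using assms(2) by auto
      then obtain b' where b': "(y, a, b') \<in> set M" by auto
      then have "(y, a, \<not> b') \<in> flip2 ` set M" by (metis flip2.simps image_eqI)
      with b' u show "u \<in> set (M @ map flip2 M)" by (cases "b = b'") auto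
    qed
  qed
qed

text \<open>
  For a Hamiltonian path \<open>p\<close> that closes to a cycle: the closing edge is deleted in all rows, and the
  copies are joined by edges flipping \<open>s1\<close> at \<open>hd p\<close> and edges flipping both bits at \<open>last p\<close>.
\<close>

definition link :: "'a list \<Rightarrow> ('a \<times> bool \<times> bool) list" where
  "link p = map (\<lambda>y. (y, False, False)) p @ map (\<lambda>y. (y, True, True)) (rev p) @
            map (\<lambda>y. (y, False, True)) p @ map (\<lambda>y. (y, True, False)) (rev p)"

text \<open>A local description of the arcs of \<open>link\<close>; disjointness of the new cycles
  is decided arc by arc from predicates of this kind.\<close>

fun link_arc :: "'a set set \<Rightarrow> 'a \<Rightarrow> 'a \<Rightarrow> 'a \<times> bool \<times> bool \<Rightarrow> 'a \<times> bool \<times> bool \<Rightarrow> bool" where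
  "link_arc E p r (y, s1, s2) (y', s1', s2') \<longleftrightarrow>
     ({y, y'} \<in> E \<and> {y, y'} \<noteq> {p, r} \<and> s1' = s1 \<and> s2' = s2) \<or>
     (y = p \<and> y' = p \<and> s1' \<noteq> s1 \<and> s2' = s2) \<or>
     (y = r \<and> y' = r \<and> s1' \<noteq> s1 \<and> s2' \<noteq> s2)"

lemma set_link: "set (link p) = set p \<times> UNIV"
  unfolding link_def by auto

lemma distinct_link: "distinct p \<Longrightarrow> distinct (link p)"
  unfolding link_def by (auto simp: distinct_map inj_on_def)

lemma link_arcs:
  assumes "distinct p" "3 \<le> length p"
  shows "\<forall>(u, v)\<in>cyc_arcs (link p). link_arc (cyc_edges p) (hd p) (last p) u v"
proof -
  let ?S = "\<lambda>u v. {u, v} \<in> cyc_edges p \<and> {u, v} \<noteq> {hd p, last p}"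
  have ne: "p \<noteq> []" using assms(2) by auto
  have S: "successively ?S p"
    unfolding successively_iff_infix
  proof (intro allI impI)
    fix l1 u v l2 assume p: "p = l1 @ u # v # l2"
    have "{u, v} \<in> cyc_edges p" using infix_cyc_arcs[of u v l1 l2] by (simp add: cyc_edges_iff p)
    moreover have "{u, v} \<noteq> {hd p, last p}"
      using assms unfolding p by (cases l1; cases l2 rule: rev_cases) (auto simp: doubleton_eq_iff)
    ultimately show "?S u v" by simp
  qed
  have S': "successively ?S (rev p)"
    using S by (simp add: successively_rev insert_commute)
  have "successively (link_arc (cyc_edges p) (hd p) (last p)) (link p @ [hd (link p)])"
    unfolding link_def using ne S S'
    by (simp add: successively_append_iff successively_map hd_map last_map hd_rev last_rev)
  moreover have "link p \<noteq> []" using ne by (simp add: link_def)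
  ultimately show ?thesis by (simp add: cyc_arcs_all_iff)
qed

text \<open>The chords on which the blocks of the next system rely are found among these surviving
  edges.\<close>

lemma link_edges:
  assumes "{y, y'} \<in> cyc_edges p" "{y, y'} \<noteq> {hd p, last p}"
  shows "{(y, s1, s2), (y', s1, s2)} \<in> cyc_edges (link p)"
proof -
  have *: "{(u, s1, s2), (v, s1, s2)} \<in> cyc_edges (link p)"
    if uv: "(u, v) \<in> cyc_arcs p" "{u, v} \<noteq> {hd p, last p}" for u v
  proof -
    have "p \<noteq> []" using uv by (auto simp: cyc_arcs_def)
    then obtain l1 l2 where l: "p @ [hd p] = l1 @ u # v # l2" using uv(1) by (auto simp: cyc_arcs_iff)
    \<comment> \<open>An empty \<open>l2\<close> would make \<open>(u, v)\<close> the closing arc,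
      which is the deleted edge.\<close>
    have "l2 \<noteq> []"
    proof
      assume "l2 = []"
      then have "p @ [hd p] = (l1 @ [u]) @ [v]" using l by (simp only: append_assoc append_Cons append_Nil)
      then have "p = l1 @ [u] \<and> hd p = v" by (rule append1_eq_conv[THEN iffD1])
      then show False using uv(2) by (metis insert_commute last_snoc)
    qed
    then obtain l3 x where "l2 = l3 @ [x]" by (cases l2 rule: rev_cases) auto
    then have p: "p = l1 @ u # v # l3" using l by simp
    have fwd: "map f p = map f l1 @ f u # f v # map f l3"
      and bwd: "map f (rev p) = map f (rev l3) @ f v # f u # map f (rev l1)"
      for f :: "'a \<Rightarrow> 'a \<times> bool \<times> bool" by (simp_all add: p)
    have mid: "{a, b} \<in> cyc_edges (k1 @ (k2 @ a # b # k3) @ k4)"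
      for a b :: "'a \<times> bool \<times> bool" and k1 k2 k3 k4
      using infix_cyc_arcs[of a b "k1 @ k2" "k3 @ k4"] by (simp add: cyc_edges_iff)
    show ?thesis
      apply (cases s1; cases s2)
      subgoal using mid[of "(v, s1, s2)" "(u, s1, s2)" "map (\<lambda>y. (y, False, False)) p"
          "map (\<lambda>y. (y, s1, s2)) (rev l3)" "map (\<lambda>y. (y, s1, s2)) (rev l1)"]
        unfolding link_def bwd[of "\<lambda>y. (y, True, True)"] by (simp add: insert_commute)
      subgoal using mid[of "(v, s1, s2)" "(u, s1, s2)"
          "map (\<lambda>y. (y, False, False)) p @ map (\<lambda>y. (y, True, True)) (rev p) @ map (\<lambda>y. (y, False, True)) p"
          "map (\<lambda>y. (y, s1, s2)) (rev l3)" "map (\<lambda>y. (y, s1, s2)) (rev l1)" "[]"]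
        unfolding link_def bwd[of "\<lambda>y. (y, True, False)"] by (simp add: insert_commute)
      subgoal using mid[of "(u, s1, s2)" "(v, s1, s2)"
          "map (\<lambda>y. (y, False, False)) p @ map (\<lambda>y. (y, True, True)) (rev p)"
          "map (\<lambda>y. (y, s1, s2)) l1" "map (\<lambda>y. (y, s1, s2)) l3"]
        unfolding link_def fwd[of "\<lambda>y. (y, False, True)"] by simp
      subgoal using mid[of "(u, s1, s2)" "(v, s1, s2)" "[]"
          "map (\<lambda>y. (y, s1, s2)) l1" "map (\<lambda>y. (y, s1, s2)) l3"]
        unfolding link_def fwd[of "\<lambda>y. (y, False, False)"] by simp
      done
  qed
  show ?thesis using assms * by (auto simp: cyc_edges_iff insert_commute)
qed

text \<open>
  In \<open>stair\<close> and \<open>weave\<close> the alternating colouring \<open>k\<close> of the given cycle determines \<open>s1\<close>: a stair enters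
  the column of \<open>y\<close> in a row with \<open>s1 = k y\<close>, and the complementary weave in a row with \<open>s1 = (\<not> k y)\<close>.
\<close>

definition stair :: "('a \<Rightarrow> bool) \<Rightarrow> bool \<Rightarrow> 'a list \<Rightarrow> ('a \<times> bool \<times> bool) list" where
  "stair k z ys = concat (map (\<lambda>y. [(y, k y, z), (y, \<not> k y, z)]) ys)"

lemma stair_simps [simp]:
  "stair k z [] = []"
  "stair k z (y # ys) = (y, k y, z) # (y, \<not> k y, z) # stair k z ys"
  "stair k z (xs @ ys) = stair k z xs @ stair k z ys"
  by (simp_all add: stair_def)

lemma length_stair [simp]: "length (stair k z ys) = 2 * length ys"
  by (induction ys) simp_all

lemma stair_successively:
  assumes "successively S (y # ys @ [y'])"
    and "\<And>a b. S a b \<Longrightarrow> T (a, \<not> k a, z) (b, k b, z)"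
    and "\<And>a. a \<in> set ys \<Longrightarrow> T (a, k a, z) (a, \<not> k a, z)"
  shows "successively T ((y, \<not> k y, z) # stair k z ys @ [(y', k y', z)])"
  using assms by (induction ys arbitrary: y) simp_all

fun weave :: "('a \<Rightarrow> bool) \<Rightarrow> ('a \<Rightarrow> bool) \<Rightarrow> bool \<Rightarrow> 'a list \<Rightarrow> ('a \<times> bool \<times> bool) list" where
  "weave k d z [] = []"
| "weave k d z (y # ys) = (y, \<not> k y, z) # (y, k y, z \<noteq> d y) # weave k d (z \<noteq> d y) ys"

lemma proj_weave:
  "map (\<lambda>(y, a, b). (y, a)) (weave k d z ys) = concat (map (\<lambda>y. [(y, \<not> k y), (y, k y)]) ys)"
  by (induction ys arbitrary: z) simp_all

text \<open>Every column satisfying \<open>d\<close> toggles \<open>s2\<close>, so the parity of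
  their number decides in which \<open>s2\<close> the weave arrives.\<close>

lemma weave_successively:
  assumes "successively S (ys @ [y'])"
    and "\<And>a b z. S a b \<Longrightarrow> T (a, k a, z) (b, \<not> k b, z)"
    and "\<And>a z. a \<in> set ys \<Longrightarrow> T (a, \<not> k a, z) (a, k a, z \<noteq> d a)"
  shows "successively T (weave k d z ys @ [(y', \<not> k y', z \<noteq> odd (length (filter d ys)))])"
  using assms
proof (induction ys arbitrary: z)
  case (Cons a ys)
  have "successively T (weave k d (z \<noteq> d a) ys @ [(y', \<not> k y', (z \<noteq> d a) \<noteq> odd (length (filter d ys)))])"
    using Cons.prems by (intro Cons.IH) (auto simp: successively_Cons)
  moreover have "((z \<noteq> d a) \<noteq> odd (length (filter d ys))) = (z \<noteq> odd (length (filter d (a # ys))))"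
    by auto
  moreover have "T (a, \<not> k a, z) (a, k a, z \<noteq> d a)" using Cons.prems(3) by simp
  moreover have "T (a, k a, z \<noteq> d a) (b, \<not> k b, z \<noteq> d a)" if "S a b" for b
    using Cons.prems(2) that by simp
  ultimately show ?case using Cons.prems(1)
    by (cases ys) simp_all
qed simp

section \<open>Alternating colourings by parity of position\<close>

lemma alternating_ends:
  "successively (\<lambda>a b. k b = (\<not> k a)) (a # m @ [b]) \<Longrightarrow> k b = (k a = odd (length m))"
  by (induction m arbitrary: a) auto

definition par :: "'a list \<Rightarrow> 'a \<Rightarrow> bool" where
  "par xs y = odd (length (takeWhile (\<lambda>z. z \<noteq> y) xs))"

lemma par_nth: "distinct xs \<Longrightarrow> i < length xs \<Longrightarrow> par xs (xs ! i) = odd i"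
proof -
  assume "distinct xs" "i < length xs"
  then have "length (takeWhile (\<lambda>z. z \<noteq> xs ! i) xs) = i"
    by (induction xs arbitrary: i) (auto simp: nth_Cons split: nat.splits)
  then show ?thesis by (simp add: par_def)
qed

lemma par_cyc_arcs:
  assumes "distinct xs" "even (length xs)" "(u, v) \<in> cyc_arcs xs"
  shows "par xs v = (\<not> par xs u)"
proof -
  obtain i where i: "i < length xs" "u = xs ! i" "v = xs ! (Suc i mod length xs)"
    using assms(3) unfolding cyc_arcs_nth by blast
  have "Suc i mod length xs < length xs" using i(1) by (intro mod_less_divisor) (cases xs, simp_all)
  then have "par xs v = odd (Suc i mod length xs)" "par xs u = odd i"
    using i assms(1) by (simp_all add: par_nth)
  \<comment> \<open>At the closing arc the index drops from \<open>length xs - 1\<close>, which is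
    odd, to 0.\<close>
  moreover have "odd (Suc i mod length xs) = even i"
    using assms(2) i(1) by (cases "Suc i = length xs") (metis even_Suc mod_self even_zero, simp)
  ultimately show ?thesis by simp
qed

text \<open>The antipode lies \<open>length l\<close> places further on, and this distance is
  even.\<close>

lemma par_half:
  assumes "distinct (l @ map c l)" "even (length l)" "y \<in> set l"
  shows "par (l @ map c l) (c y) = par (l @ map c l) y"
proof -
  obtain i where i: "i < length l" "y = l ! i" using assms(3) by (auto simp: in_set_conv_nth)
  then have "y = (l @ map c l) ! i" "c y = (l @ map c l) ! (length l + i)"
    by (simp_all add: nth_append)
  then show ?thesis using assms(1,2) i(1) by (simp only: par_nth length_append length_map) simp
qed

section \<open>Two cycles from one antipodal cycle\<close>

text \<open>The order of the two values of \<open>s2\<close> depends on \<open>k\<close>: if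
  \<open>k\<close> alternates along the list, the value in which a column is left is the one in
  which the next column is entered.\<close>

definition rungs :: "('a \<Rightarrow> bool) \<Rightarrow> bool \<Rightarrow> 'a list \<Rightarrow> ('a \<times> bool \<times> bool) list" where
  "rungs k s ys = concat (map (\<lambda>y. [(y, s, s \<noteq> k y), (y, s, s = k y)]) ys)"

lemma rungs_simps [simp]:
  "rungs k s [] = []"
  "rungs k s (y # ys) = (y, s, s \<noteq> k y) # (y, s, s = k y) # rungs k s ys"
  "rungs k s (xs @ ys) = rungs k s xs @ rungs k s ys"
  by (simp_all add: rungs_def)

lemma length_rungs [simp]: "length (rungs k s ys) = 2 * length ys"
  by (induction ys) simp_all

lemma set_rungs: "set (rungs k s ys) = set ys \<times> {s} \<times> UNIV"
  by (induction ys) auto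

lemma rungs_successively:
  assumes "successively S (y # ys @ [y'])"
    and "\<And>a b. S a b \<Longrightarrow> T (a, s, s = k a) (b, s, s \<noteq> k b)"
    and "\<And>a. a \<in> set ys \<Longrightarrow> T (a, s, s \<noteq> k a) (a, s, s = k a)"
  shows "successively T ((y, s, s = k y) # rungs k s ys @ [(y', s, s \<noteq> k y')])"
  using assms by (induction ys arbitrary: y) simp_all

text \<open>\<open>h\<close> tells whether the current column is entered at the antipode; each
  antipodal edge changes this side, while \<open>s2\<close> stays at \<open>z\<close>.\<close>

fun zigzag :: "('a \<Rightarrow> bool) \<Rightarrow> ('a \<Rightarrow> 'a) \<Rightarrow> bool \<Rightarrow> bool \<Rightarrow> 'a list \<Rightarrow> ('a \<times> bool \<times> bool) list" where
  "zigzag k c z h [] = []"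
| "zigzag k c z h (y # ys) =
     (if h then c y else y, z = k y, z) # (if h then y else c y, z \<noteq> k y, z) # zigzag k c z (\<not> h) ys"

lemma length_zigzag [simp]: "length (zigzag k c z h ys) = 2 * length ys"
  by (induction ys arbitrary: h) simp_all

lemma set_zigzag:
  "set (zigzag k c z False ys) \<union> set (zigzag k c z True ys) = (set ys \<union> c ` set ys) \<times> UNIV \<times> {z}"
  by (induction ys) auto

lemma zigzag_successively:
  assumes "successively S (y # ys @ [y'])"
    and "\<And>a b. S a b \<Longrightarrow> T (a, z \<noteq> k a, z) (b, z = k b, z) \<and> T (c a, z \<noteq> k a, z) (c b, z = k b, z)"
    and "\<And>a. a \<in> set ys \<Longrightarrow> T (a, z = k a, z) (c a, z \<noteq> k a, z) \<and> T (c a, z = k a, z) (a, z \<noteq> k a, z)"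
  shows "successively T ((if h then c y else y, z \<noteq> k y, z) # zigzag k c z h ys @
           [(if h \<noteq> odd (length ys) then c y' else y', z = k y', z)])"
  using assms
proof (induction ys arbitrary: y h)
  case (Cons a ys)
  from Cons.prems(1) have "S y a" "successively S (a # ys @ [y'])" by simp_all
  moreover have "successively T ((if \<not> h then c a else a, z \<noteq> k a, z) # zigzag k c z (\<not> h) ys @
           [(if (\<not> h) \<noteq> odd (length ys) then c y' else y', z = k y', z)])"
    using calculation(2) by (rule Cons.IH) (use Cons.prems(2,3) in auto)
  ultimately show ?case
    using Cons.prems(2)[of y a] Cons.prems(3)[of a] by (cases h) (simp_all cong: if_cong)
qed simp

text \<open>
  The first cycle uses the edges flipping \<open>s2\<close>, the second one those of the form
  \<open>(y, s1, s2) \<mapsto> (c y, \<not> s1, s2)\<close>. Each of them alone would fall apart into two cycles; exchanging the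
  roles of the two kinds of edges on the single 4-cycle described by \<open>swap_rows\<close> joins the parts on both
  sides.
\<close>

definition swap_rows :: "('a \<Rightarrow> 'a) \<Rightarrow> 'a \<Rightarrow> 'a \<Rightarrow> bool \<Rightarrow> bool" where
  "swap_rows c y0 y s \<longleftrightarrow> (y = y0 \<and> \<not> s) \<or> (y = c y0 \<and> s)"

fun pair_arc1 :: "('a \<Rightarrow> bool) \<Rightarrow> ('a \<Rightarrow> 'a) \<Rightarrow> 'a \<Rightarrow> ('a \<times> 'a) set \<Rightarrow>
    'a \<times> bool \<times> bool \<Rightarrow> 'a \<times> bool \<times> bool \<Rightarrow> bool" where
  "pair_arc1 k c y0 E (y, s1, s2) (y', s1', s2') \<longleftrightarrow>
     (if (s1 \<noteq> s2) = k y
      then (if swap_rows c y0 y s1 then y' = c y \<and> s1' \<noteq> s1 \<and> s2' = s2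
            else y' = y \<and> s1' = s1 \<and> s2' \<noteq> s2)
      else (y, y') \<in> E \<and> s1' = s1 \<and> s2' = s2)"

fun pair_arc2 :: "('a \<Rightarrow> bool) \<Rightarrow> ('a \<Rightarrow> 'a) \<Rightarrow> 'a \<Rightarrow> ('a \<times> 'a) set \<Rightarrow>
    'a \<times> bool \<times> bool \<Rightarrow> 'a \<times> bool \<times> bool \<Rightarrow> bool" where
  "pair_arc2 k c y0 E (y, s1, s2) (y', s1', s2') \<longleftrightarrow>
     (if (s1 \<noteq> s2) = k y
      then (y, y') \<in> E \<and> s1' = s1 \<and> s2' = s2
      else (if swap_rows c y0 y s1 then y' = y \<and> s1' = s1 \<and> s2' \<noteq> s2
            else y' = c y \<and> s1' \<noteq> s1 \<and> s2' = s2))"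

text \<open>One turn along the whole cycle with \<open>s1 = True\<close> and one with
  \<open>s1 = False\<close>, joined by the two exchanged antipodal edges between \<open>y0\<close>
  and \<open>c y0\<close>.\<close>

definition pair1 :: "('a \<Rightarrow> bool) \<Rightarrow> ('a \<Rightarrow> 'a) \<Rightarrow> 'a \<Rightarrow> 'a list \<Rightarrow> ('a \<times> bool \<times> bool) list" where
  "pair1 k c y0 ys =
     (y0, False, k y0) # (c y0, True, k y0) # rungs k True (map c ys @ y0 # ys) @
     (c y0, True, \<not> k y0) # (y0, False, \<not> k y0) # rungs k False (ys @ c y0 # map c ys)"

text \<open>Four zigzags, one for each value of \<open>s2\<close> and each starting side. Antipodal
  edges join those with equal \<open>s2\<close>; the exchanged edges at \<open>y0\<close> and
  \<open>c y0\<close> join the two values of \<open>s2\<close>.\<close>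

definition pair2 :: "('a \<Rightarrow> bool) \<Rightarrow> ('a \<Rightarrow> 'a) \<Rightarrow> 'a \<Rightarrow> 'a list \<Rightarrow> ('a \<times> bool \<times> bool) list" where
  "pair2 k c y0 ys =
     (y0, False, \<not> k y0) # (y0, False, k y0) # zigzag k c (k y0) False ys @
     (y0, True, k y0) # (c y0, False, k y0) # zigzag k c (k y0) True ys @
     (c y0, True, k y0) # (c y0, True, \<not> k y0) # zigzag k c (\<not> k y0) True ys @
     (c y0, False, \<not> k y0) # (y0, True, \<not> k y0) # zigzag k c (\<not> k y0) False ys"

lemma successively_join:
  "successively P (xs @ [x]) \<Longrightarrow> successively P (x # ys) \<Longrightarrow> successively P (xs @ x # ys)"
  by (simp add: successively_append_iff)

text \<open>\<open>E\<close> is meant as the set of arcs of the cycle in a fixed orientation, and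
  \<open>y0\<close> is the place where the two kinds of edges exchange their roles.\<close>

locale antipodal_cycle =
  fixes c :: "'a \<Rightarrow> 'a" and y0 :: 'a and ys :: "'a list"
    and k :: "'a \<Rightarrow> bool" and E :: "('a \<times> 'a) set"
  assumes invol: "c (c y) = y"
    and dist: "distinct ((y0 # ys) @ map c (y0 # ys))"
    and odd_ys: "odd (length ys)"
    and k_c: "y \<in> set ((y0 # ys) @ map c (y0 # ys)) \<Longrightarrow> k (c y) = k y"
    and k_E: "(u, v) \<in> E \<Longrightarrow> k v = (\<not> k u)"
    and chain: "successively (\<lambda>u v. (u, v) \<in> E) (y0 # ys @ [c y0])"
    and chain': "successively (\<lambda>u v. (u, v) \<in> E) (c y0 # map c ys @ [y0])"
begin

definition V where "V = set ((y0 # ys) @ map c (y0 # ys))"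

lemma k0: "k (c y0) = k y0" by (rule k_c) simp

lemma c_y0_neq: "c y0 \<noteq> y0" using dist by auto

lemma y0_notin: "y0 \<notin> set ys" "c y0 \<notin> set ys" "y0 \<notin> c ` set ys" "c y0 \<notin> c ` set ys"
proof -
  show "y0 \<notin> set ys" "c y0 \<notin> set ys" "y0 \<notin> c ` set ys" "c y0 \<notin> c ` set ys"
    using dist by auto
qed

lemma c_eq_iff: "c a = c b \<longleftrightarrow> a = b"
  using invol by metis

text \<open>Distinctness of both lists is obtained by counting: they cover
  \<open>V \<times> UNIV\<close> and have as many entries as it has elements.\<close>

lemma card_V: "card (V \<times> (UNIV :: (bool \<times> bool) set)) = 8 * Suc (length ys)"
proof -
  have "card (UNIV :: (bool \<times> bool) set) = 4"
    by (simp add: card_cartesian_product flip: UNIV_Times_UNIV)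
  moreover have "card V = 2 * Suc (length ys)" unfolding V_def using distinct_card[OF dist] by simp
  ultimately show ?thesis by (simp only: card_cartesian_product)
qed

lemma set_pair1: "set (pair1 k c y0 ys) = V \<times> UNIV"
proof -
  have "set (pair1 k c y0 ys) =
      {(c y0, True, k y0), (c y0, True, \<not> k y0)} \<union> set (map c ys @ y0 # ys) \<times> {True} \<times> UNIV \<union>
      ({(y0, False, k y0), (y0, False, \<not> k y0)} \<union> set (ys @ c y0 # map c ys) \<times> {False} \<times> UNIV)"
    unfolding pair1_def by (simp only: set_simps set_append set_rungs) blast
  also have "{(c y0, True, k y0), (c y0, True, \<not> k y0)} = {c y0} \<times> {True} \<times> UNIV"
    by (cases "k y0") auto
  also have "{(y0, False, k y0), (y0, False, \<not> k y0)} = {y0} \<times> {False} \<times> UNIV"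
    by (cases "k y0") auto
  also have "{c y0} \<times> {True} \<times> UNIV \<union> set (map c ys @ y0 # ys) \<times> {True} \<times> UNIV = V \<times> {True} \<times> (UNIV :: bool set)"
    unfolding V_def by auto
  also have "{y0} \<times> {False} \<times> UNIV \<union> set (ys @ c y0 # map c ys) \<times> {False} \<times> UNIV = V \<times> {False} \<times> (UNIV :: bool set)"
    unfolding V_def by auto
  also have "V \<times> {True} \<times> (UNIV :: bool set) \<union> V \<times> {False} \<times> UNIV = V \<times> UNIV" by auto
  finally show ?thesis .
qed

lemma distinct_pair1: "distinct (pair1 k c y0 ys)"
proof (rule card_distinct)
  have "length (pair1 k c y0 ys) = 8 * Suc (length ys)" by (simp add: pair1_def)
  then show "card (set (pair1 k c y0 ys)) = length (pair1 k c y0 ys)"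
    by (simp only: set_pair1 card_V)
qed

lemma pair1_arcs: "\<forall>(u, v)\<in>cyc_arcs (pair1 k c y0 ys). pair_arc1 k c y0 E u v"
proof -
  let ?S = "\<lambda>u v. (u, v) \<in> E" and ?T = "pair_arc1 k c y0 E"
  have 1: "successively ?T ((c y0, True, True = k (c y0)) # rungs k True (map c ys @ y0 # ys) @
      [(c y0, True, True \<noteq> k (c y0))])"
    using successively_join[of ?S "c y0 # map c ys" y0 "ys @ [c y0]"] chain chain'
    by (intro rungs_successively[where S = ?S])
      (use y0_notin c_y0_neq k_E in \<open>auto simp: swap_rows_def\<close>)
  have 2: "successively ?T ((y0, False, False = k y0) # rungs k False (ys @ c y0 # map c ys) @
      [(y0, False, False \<noteq> k y0)])"
    using successively_join[of ?S "y0 # ys" "c y0" "map c ys @ [y0]"] chain chain'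
    by (intro rungs_successively[where S = ?S])
      (use y0_notin c_y0_neq k_E in \<open>auto simp: swap_rows_def\<close>)
  have "successively ?T (((c y0, True, True = k (c y0)) # rungs k True (map c ys @ y0 # ys) @
      [(c y0, True, True \<noteq> k (c y0))]) @ ((y0, False, False = k y0) # rungs k False (ys @ c y0 # map c ys) @
      [(y0, False, False \<noteq> k y0)]))"
    using 1 2 c_y0_neq
    by (subst successively_append_iff) (auto simp: swap_rows_def invol k0 simp del: rungs_simps(3))
  then have "successively ?T (pair1 k c y0 ys @ [hd (pair1 k c y0 ys)])"
    using k0 unfolding pair1_def by (simp add: swap_rows_def del: rungs_simps(3))
  moreover have "pair1 k c y0 ys \<noteq> []" by (simp add: pair1_def)
  ultimately show ?thesis by (intro cyc_arcs_all_iff[THEN iffD2])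
qed

lemma set_pair2: "set (pair2 k c y0 ys) = V \<times> UNIV"
proof -
  have "set (pair2 k c y0 ys) =
      (set (zigzag k c (k y0) False ys) \<union> set (zigzag k c (k y0) True ys)) \<union>
      (set (zigzag k c (\<not> k y0) False ys) \<union> set (zigzag k c (\<not> k y0) True ys)) \<union>
      {y0, c y0} \<times> UNIV \<times> UNIV"
    unfolding pair2_def by (cases "k y0") auto
  then show ?thesis unfolding set_zigzag V_def by auto
qed

lemma distinct_pair2: "distinct (pair2 k c y0 ys)"
proof (rule card_distinct)
  have "length (pair2 k c y0 ys) = 8 * Suc (length ys)" by (simp add: pair2_def)
  then show "card (set (pair2 k c y0 ys)) = length (pair2 k c y0 ys)"
    by (simp only: set_pair2 card_V)
qed

lemma pair2_arcs: "\<forall>(u, v)\<in>cyc_arcs (pair2 k c y0 ys). pair_arc2 k c y0 E u v"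
proof -
  let ?S = "\<lambda>u v. (u, v) \<in> E \<and> (c u, c v) \<in> E" and ?T = "pair_arc2 k c y0 E"
  \<comment> \<open>A zigzag follows an arc on either side, so each arc of the first half is paired
    with its image in the second half.\<close>
  have ch: "successively (\<lambda>a b. ?S a b \<and> k (c a) = k a) (y0 # ys @ [c y0])"
    unfolding successively_iff_infix
  proof (intro allI impI)
    fix l1 u v l2 assume l: "y0 # ys @ [c y0] = l1 @ u # v # l2"
    have "map c (y0 # ys @ [c y0]) = map c l1 @ c u # c v # map c l2" by (simp add: l)
    then have "c y0 # map c ys @ [y0] = map c l1 @ c u # c v # map c l2" by (simp add: invol)
    then have "(u, v) \<in> E" "(c u, c v) \<in> E"
      using chain chain' l unfolding successively_iff_infix by blast+
    moreover have "u \<in> set (y0 # ys @ [c y0])" unfolding l by simp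
    ultimately show "?S u v \<and> k (c u) = k u" using k_c[of u] by auto
  qed
  have seg: "successively ?T ((if h then c y0 else y0, z \<noteq> k y0, z) # zigzag k c z h ys @
       [(if h then c y0 else y0, z = k y0, z)])" for z h
  proof -
    have a: "pair_arc2 k c y0 E (a, z \<noteq> k a, z) (b, z = k b, z) \<and>
        pair_arc2 k c y0 E (c a, z \<noteq> k a, z) (c b, z = k b, z)"
      if "?S a b" "k (c a) = k a" for a b
      using k_E[of a b] that by auto
    from ch have "successively ?T ((if h then c y0 else y0, z \<noteq> k y0, z) # zigzag k c z h ys @
       [(if h \<noteq> odd (length ys) then c (c y0) else c y0, z = k (c y0), z)])"
      by (rule zigzag_successively) (use a k_c y0_notin in \<open>auto simp: invol swap_rows_def c_eq_iff\<close>)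
    \<comment> \<open>The odd number of columns in \<open>ys\<close> changes the side, and ending at
      \<open>c y0\<close> instead of \<open>y0\<close> undoes this: the segment returns to its
      initial column with \<open>s1\<close> flipped.\<close>
    then show ?thesis using odd_ys by (cases h) (simp_all add: invol k0)
  qed
  have "successively ?T ([(y0, False, \<not> k y0)] @ ((y0, False, k y0) # zigzag k c (k y0) False ys @
     [(y0, True, k y0)]) @ ((c y0, False, k y0) # zigzag k c (k y0) True ys @
     [(c y0, True, k y0)]) @ ((c y0, True, \<not> k y0) # zigzag k c (\<not> k y0) True ys @
     [(c y0, False, \<not> k y0)]) @ ((y0, True, \<not> k y0) # zigzag k c (\<not> k y0) False ys @ [(y0, False, \<not> k y0)]))"
    using seg[of False "k y0"] seg[of True "k y0"] seg[of True "\<not> k y0"] seg[of False "\<not> k y0"] c_y0_neq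
    unfolding successively_append_iff[of _ "_ # _ @ [_]"] successively_append_iff[of _ "[_]"]
    by (auto simp: swap_rows_def invol k0)
  then have "successively ?T (pair2 k c y0 ys @ [hd (pair2 k c y0 ys)])"
    unfolding pair2_def by (simp add: swap_rows_def)
  moreover have "pair2 k c y0 ys \<noteq> []" by (simp add: pair2_def)
  ultimately show ?thesis by (intro cyc_arcs_all_iff[THEN iffD2])
qed

end

section \<open>Systems with crossing chords\<close>

lemma successively_infix: "successively P (xs @ ys @ zs) \<Longrightarrow> successively P ys"
  by (simp add: successively_append_iff)

text \<open>
  A block is a segment of \<open>C1\<close> together with a pair of cycles, of which \<open>cycA\<close> contains the chord from
  \<open>bp\<close> to \<open>br\<close> and \<open>cycB\<close> the chord from \<open>bq\<close> to \<open>bt\<close>.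
\<close>

datatype 'a block = Block (cycA: "'a list") (cycB: "'a list")
  (bp: 'a) (bu: "'a list") (bq: 'a) (bv: "'a list") (br: 'a) (bw: "'a list") (bt: 'a) (bz: "'a list")

definition cols :: "'a block \<Rightarrow> 'a list" where
  "cols b = bp b # bu b @ bq b # bv b @ br b # bw b @ bt b # bz b"

text \<open>
  The columns \<open>x0\<close>, \<dots>, \<open>x5\<close> are reserved: their antipodes carry the crossing chords of the next new pair, and
  \<open>x5\<close> is where the first cycle of the next system changes \<open>s2\<close>. In \<open>chordc\<close> the antipodal chords may
  belong to the two cycles of the pair in either order, because the construction of a new pair
  interchanges its two cycles when \<open>s2\<close> is flipped.
\<close>

locale crossed_system =
  fixes V :: "'a set" and R :: "'a \<Rightarrow> 'a \<Rightarrow> bool" and c :: "'a \<Rightarrow> 'a"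
    and x0 x1 x2 x3 x4 x5 :: 'a and Y :: "'a list" and H :: "'a list" and P :: "'a block list"
  assumes invol: "c (c y) = y"
    and sym: "R u v \<Longrightarrow> R v u"
    and ham1: "ham_list V R ((x0 # x1 # x2 # x3 # x4 # x5 # Y @ concat (map cols P)) @
                 map c (x0 # x1 # x2 # x3 # x4 # x5 # Y @ concat (map cols P)))"
    and ham2: "ham_list V R (H @ map c H)"
    and even_half: "even (length (x0 # x1 # x2 # x3 # x4 # x5 # Y @ concat (map cols P)))"
    and disj12: "cyc_edges ((x0 # x1 # x2 # x3 # x4 # x5 # Y @ concat (map cols P)) @
                 map c (x0 # x1 # x2 # x3 # x4 # x5 # Y @ concat (map cols P))) \<inter>
                 cyc_edges (H @ map c H) = {}"
    and chord03: "{x0, x3} \<in> cyc_edges (H @ map c H)"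
    and chord25: "{x2, x5} \<in> cyc_edges (H @ map c H)"
    and hamA: "b \<in> set P \<Longrightarrow> ham_list V R (cycA b)"
    and hamB: "b \<in> set P \<Longrightarrow> ham_list V R (cycB b)"
    and odd_pr: "b \<in> set P \<Longrightarrow> odd (length (bu b) + length (bv b))"
    and odd_qt: "b \<in> set P \<Longrightarrow> odd (length (bv b) + length (bw b))"
    and chordA: "b \<in> set P \<Longrightarrow> {bp b, br b} \<in> cyc_edges (cycA b)"
    and chordB: "b \<in> set P \<Longrightarrow> {bq b, bt b} \<in> cyc_edges (cycB b)"
    and chordc: "b \<in> set P \<Longrightarrow>
      ({c (bp b), c (br b)} \<in> cyc_edges (cycA b) \<and> {c (bq b), c (bt b)} \<in> cyc_edges (cycB b)) \<or>
      ({c (bp b), c (br b)} \<in> cyc_edges (cycB b) \<and> {c (bq b), c (bt b)} \<in> cyc_edges (cycA b))"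
    and disjAB: "b \<in> set P \<Longrightarrow> cyc_edges (cycA b) \<inter> cyc_edges (cycB b) = {}"
    and disj1: "b \<in> set P \<Longrightarrow> (cyc_edges (cycA b) \<union> cyc_edges (cycB b)) \<inter>
                 cyc_edges ((x0 # x1 # x2 # x3 # x4 # x5 # Y @ concat (map cols P)) @
                 map c (x0 # x1 # x2 # x3 # x4 # x5 # Y @ concat (map cols P))) = {}"
    and disj2: "b \<in> set P \<Longrightarrow> (cyc_edges (cycA b) \<union> cyc_edges (cycB b)) \<inter> cyc_edges (H @ map c H) = {}"
    and disjP: "b \<in> set P \<Longrightarrow> b' \<in> set P \<Longrightarrow> b \<noteq> b' \<Longrightarrow>
      (cyc_edges (cycA b) \<union> cyc_edges (cycB b)) \<inter> (cyc_edges (cycA b') \<union> cyc_edges (cycB b')) = {}"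
begin

definition L where "L = x0 # x1 # x2 # x3 # x4 # x5 # Y @ concat (map cols P)"
definition C1 where "C1 = L @ map c L"
definition C2 where "C2 = H @ map c H"
definition E1 where "E1 = cyc_arcs C1"
definition E2 where "E2 = cyc_arcs C2"
definition k where "k = par C1"
definition k2 where "k2 = par C2"
definition ends where "ends b = {bp b, bq b, br b, bt b}"
text \<open>At these columns the first new cycle does not use the edges flipping \<open>s1\<close>
  alone: at \<open>x5\<close> it flips both bits, and at the chord ends it follows the
  chords.\<close>

definition Ends where "Ends = insert x5 (\<Union>b\<in>set P. ends b)"
text \<open>At these columns the edges flipping both bits are taken, at \<open>x5\<close> by the
  first new cycle and at \<open>br\<close> and \<open>bt\<close> by the linked cycles. There the
  second new cycle has to flip \<open>s1\<close> alone.\<close>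

definition D where "D = insert x5 (\<Union>b\<in>set P. {br b, bt b})"
definition Chords where "Chords = (\<Union>b\<in>set P. {{bp b, br b}, {bq b, bt b}})"

lemma ham_C1: "distinct C1" "set C1 = V" "\<And>u v. (u, v) \<in> E1 \<Longrightarrow> R u v"
  using ham1 unfolding ham_list_def C1_def L_def E1_def by auto

lemma ham_C2: "distinct C2" "set C2 = V" "\<And>u v. (u, v) \<in> E2 \<Longrightarrow> R u v"
  using ham2 unfolding ham_list_def C2_def E2_def by auto

lemma even_L: "even (length L)" using even_half unfolding L_def .

lemma length_C1: "length C1 = card V" "length C1 = 2 * length L"
  using distinct_card[OF ham_C1(1)] ham_C1(2) by (simp_all add: C1_def)

lemma length_C2: "length C2 = card V" "length C2 = 2 * length H" "length H = length L"
  using distinct_card[OF ham_C2(1)] ham_C2(2) length_C1 by (simp_all add: C2_def)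

lemma L_ge: "6 \<le> length L" by (simp add: L_def)

lemma E1_simps: "(u, v) \<in> E1 \<Longrightarrow> k v = (\<not> k u)" "(u, v) \<in> E1 \<Longrightarrow> (v, u) \<notin> E1" "(u, u) \<notin> E1"
  "(u, v) \<in> E1 \<Longrightarrow> u \<in> V \<and> v \<in> V"
proof -
  have l: "even (length C1)" "3 \<le> length C1" "2 \<le> length C1" using length_C1(2) L_ge by simp_all
  show "(u, v) \<in> E1 \<Longrightarrow> k v = (\<not> k u)"
    unfolding E1_def k_def by (rule par_cyc_arcs[OF ham_C1(1) l(1)])
  show "(u, v) \<in> E1 \<Longrightarrow> (v, u) \<notin> E1"
    unfolding E1_def by (rule cyc_arcs_asym[OF ham_C1(1) l(2)])
  show "(u, u) \<notin> E1" unfolding E1_def by (rule cyc_arcs_irrefl[OF ham_C1(1) l(3)])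
  show "(u, v) \<in> E1 \<Longrightarrow> u \<in> V \<and> v \<in> V"
    unfolding E1_def using cyc_arcs_setD[of u v C1] ham_C1(2) by blast
qed

lemma E2_simps: "(u, v) \<in> E2 \<Longrightarrow> k2 v = (\<not> k2 u)" "(u, v) \<in> E2 \<Longrightarrow> (v, u) \<notin> E2" "(u, u) \<notin> E2"
  "(u, v) \<in> E2 \<Longrightarrow> u \<in> V \<and> v \<in> V"
proof -
  have l: "even (length C2)" "3 \<le> length C2" "2 \<le> length C2" using length_C2(2,3) L_ge by simp_all
  show "(u, v) \<in> E2 \<Longrightarrow> k2 v = (\<not> k2 u)"
    unfolding E2_def k2_def by (rule par_cyc_arcs[OF ham_C2(1) l(1)])
  show "(u, v) \<in> E2 \<Longrightarrow> (v, u) \<notin> E2"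
    unfolding E2_def by (rule cyc_arcs_asym[OF ham_C2(1) l(2)])
  show "(u, u) \<notin> E2" unfolding E2_def by (rule cyc_arcs_irrefl[OF ham_C2(1) l(3)])
  show "(u, v) \<in> E2 \<Longrightarrow> u \<in> V \<and> v \<in> V"
    unfolding E2_def using cyc_arcs_setD[of u v C2] ham_C2(2) by blast
qed

lemma E12: "(u, v) \<in> E1 \<Longrightarrow> (u, v) \<notin> E2 \<and> (v, u) \<notin> E2"
  using disj12 cyc_edges_iff[of u v C1] cyc_edges_iff[of u v C2]
  unfolding E1_def E2_def C1_def C2_def L_def by blast

lemma E1_AB: "b \<in> set P \<Longrightarrow> (u, v) \<in> E1 \<Longrightarrow> {u, v} \<notin> cyc_edges (cycA b) \<and> {u, v} \<notin> cyc_edges (cycB b)"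
  using disj1[of b] cyc_edges_iff[of u v C1] unfolding E1_def C1_def L_def by blast

lemma E2_AB: "b \<in> set P \<Longrightarrow> (u, v) \<in> E2 \<Longrightarrow> {u, v} \<notin> cyc_edges (cycA b) \<and> {u, v} \<notin> cyc_edges (cycB b)"
  using disj2[of b] cyc_edges_iff[of u v C2] unfolding E2_def C2_def by blast

lemma c_V: "y \<in> V \<Longrightarrow> c y \<in> V"
  using ham_C1(2) invol unfolding C1_def by force

lemma k_c: "y \<in> V \<Longrightarrow> k (c y) = k y"
proof -
  assume "y \<in> V"
  then consider "y \<in> set L" | "c y \<in> set L"
    using ham_C1(2) unfolding C1_def by (auto simp: invol)
  then show ?thesis
    using par_half[OF ham_C1(1)[unfolded C1_def] even_L] unfolding k_def C1_def by cases (metis invol)+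
qed

lemma k2_c: "y \<in> V \<Longrightarrow> k2 (c y) = k2 y"
proof -
  assume "y \<in> V"
  then consider "y \<in> set H" | "c y \<in> set H"
    using ham_C2(2) unfolding C2_def by (auto simp: invol)
  moreover have "even (length H)" using even_L length_C2(3) by simp
  ultimately show ?thesis
    using par_half[OF ham_C2(1)[unfolded C2_def]] unfolding k2_def C2_def by cases (metis invol)+
qed

lemma distinct_L: "distinct L" using ham_C1(1) by (simp add: C1_def)

lemma L_V: "set L \<subseteq> V" using ham_C1(2) by (auto simp: C1_def)

lemma c_L: "y \<in> set L \<Longrightarrow> c y \<notin> set L"
  using ham_C1(1) by (auto simp: C1_def)

lemma c_neq: "y \<in> V \<Longrightarrow> c y \<noteq> y"
proof -
  assume "y \<in> V"
  then consider "y \<in> set L" | z where "z \<in> set L" "y = c z"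
    using ham_C1(2) unfolding C1_def by auto
  then show ?thesis using c_L invol by cases metis+
qed

lemma cols_L:
  assumes "b \<in> set P" shows "distinct (cols b)" "set (cols b) \<subseteq> set L"
    "set (cols b) \<inter> (set [x0, x1, x2, x3, x4, x5] \<union> set Y) = {}"
  using assms distinct_L unfolding L_def by (auto simp: distinct_concat_iff)

lemma cols_disjoint:
  assumes "b \<in> set P" "b' \<in> set P" "b \<noteq> b'" shows "set (cols b) \<inter> set (cols b') = {}"
proof -
  have "distinct (concat (map cols Q)) \<Longrightarrow> b \<in> set Q \<Longrightarrow> b' \<in> set Q \<Longrightarrow> set (cols b) \<inter> set (cols b') = {}" for Q
    using assms(3) by (induction Q) auto
  moreover have "distinct (concat (map cols P))" using distinct_L by (simp add: L_def)
  ultimately show ?thesis using assms(1,2) by blast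
qed

lemma ends_cols: "ends b \<subseteq> set (cols b)"
  by (auto simp: ends_def cols_def)

lemma ends_disjoint: "b \<in> set P \<Longrightarrow> b' \<in> set P \<Longrightarrow> b \<noteq> b' \<Longrightarrow> ends b \<inter> ends b' = {}"
  using cols_disjoint[of b b'] ends_cols[of b] ends_cols[of b'] by blast

lemma ends_distinct: "b \<in> set P \<Longrightarrow> distinct [x5, bp b, bq b, br b, bt b]"
  using cols_L(1,3)[of b] by (auto simp: cols_def)

lemma Ends_L: "Ends \<subseteq> set L"
proof -
  have "x5 \<in> set L" by (simp add: L_def)
  moreover have "ends b \<subseteq> set L" if "b \<in> set P" for b
    using cols_L(2)[OF that] ends_cols[of b] by blast
  ultimately show ?thesis unfolding Ends_def by blast
qed

lemma Ends_block:
  assumes "b \<in> set P" shows "set (bu b) \<inter> Ends = {}" "set (bv b) \<inter> Ends = {}"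
    "set (bw b) \<inter> Ends = {}" "set (bz b) \<inter> Ends = {}"
proof -
  have "x5 \<notin> set (cols b)" using cols_L(3)[OF assms] by auto
  moreover have "ends b' \<inter> set (cols b) = {}" if "b' \<in> set P" "b' \<noteq> b" for b'
    using cols_disjoint[OF that(1) assms that(2)] ends_cols[of b'] by blast
  ultimately have "set (cols b) \<inter> Ends \<subseteq> ends b" unfolding Ends_def by blast
  then show "set (bu b) \<inter> Ends = {}" "set (bv b) \<inter> Ends = {}"
    "set (bw b) \<inter> Ends = {}" "set (bz b) \<inter> Ends = {}"
    using cols_L(1)[OF assms] unfolding cols_def ends_def by (auto 0 3)
qed

lemma Ends_rest: "x0 \<notin> Ends" "x1 \<notin> Ends" "x2 \<notin> Ends" "x3 \<notin> Ends" "x4 \<notin> Ends" "set Y \<inter> Ends = {}"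
  "set (map c L) \<inter> Ends = {}"
proof -
  have "ends b \<inter> (set [x0, x1, x2, x3, x4] \<union> set Y) = {}" if "b \<in> set P" for b
    using cols_L(3)[OF that] ends_cols[of b] by auto
  moreover have "x5 \<notin> set [x0, x1, x2, x3, x4] \<union> set Y" using distinct_L by (auto simp: L_def)
  ultimately have "Ends \<inter> (set [x0, x1, x2, x3, x4] \<union> set Y) = {}" unfolding Ends_def by blast
  then show "x0 \<notin> Ends" "x1 \<notin> Ends" "x2 \<notin> Ends" "x3 \<notin> Ends" "x4 \<notin> Ends" "set Y \<inter> Ends = {}"
    by auto
  show "set (map c L) \<inter> Ends = {}" using Ends_L c_L by auto
qed

lemma successively_E1: "successively (\<lambda>u v. (u, v) \<in> E1) (C1 @ [x0])"
proof -
  have "hd C1 = x0" "C1 \<noteq> []" by (simp_all add: C1_def L_def)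
  then show ?thesis using cyc_arcs_all_iff[of C1 "\<lambda>u v. (u, v) \<in> E1"] unfolding E1_def by auto
qed

text \<open>The chords span odd distances along \<open>C1\<close>, where \<open>k\<close>
  alternates. Hence the row in which a stair enters one end is the row in which it leaves the other,
  and a copy of the chord connects the two.\<close>

lemma k_chord:
  assumes "b \<in> set P" shows "k (br b) = (\<not> k (bp b))" "k (bt b) = (\<not> k (bq b))"
proof -
  obtain Z1 Z2 where Z: "C1 = Z1 @ cols b @ Z2"
  proof -
    obtain P1 P2 where "P = P1 @ b # P2" using assms by (meson split_list)
    then have "concat (map cols P) = concat (map cols P1) @ cols b @ concat (map cols P2)" by simp
    then have "C1 = ((x0 # x1 # x2 # x3 # x4 # x5 # Y) @ concat (map cols P1)) @ cols b @
        (concat (map cols P2) @ map c L)"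
      unfolding C1_def by (subst (1) L_def) simp
    then show thesis by (rule that)
  qed
  have "successively (\<lambda>u v. k v = (\<not> k u)) (C1 @ [x0])"
    using successively_E1 by (rule successively_mono) (rule E1_simps(1))
  then have s: "successively (\<lambda>u v. k v = (\<not> k u)) (cols b)"
    unfolding Z by (simp add: successively_append_iff)
  have "cols b = [] @ (bp b # (bu b @ bq b # bv b) @ [br b]) @ (bw b @ bt b # bz b)"
    by (simp add: cols_def)
  then have "successively (\<lambda>u v. k v = (\<not> k u)) (bp b # (bu b @ bq b # bv b) @ [br b])"
    using s by (metis successively_infix)
  from alternating_ends[OF this] show "k (br b) = (\<not> k (bp b))" using odd_pr[OF assms] by simp
  have "cols b = (bp b # bu b) @ (bq b # (bv b @ br b # bw b) @ [bt b]) @ bz b"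
    by (simp add: cols_def)
  then have "successively (\<lambda>u v. k v = (\<not> k u)) (bq b # (bv b @ br b # bw b) @ [bt b])"
    using s by (metis successively_infix)
  from alternating_ends[OF this] show "k (bt b) = (\<not> k (bq b))" using odd_qt[OF assms] by simp
qed

end

text \<open>
  The stair over a block, with its vertical edges at the four chord ends replaced by the chords, so that
  the three inner segments are traversed in reverse order, each still in its original direction.
\<close>

definition pert :: "('a \<Rightarrow> bool) \<Rightarrow> 'a block \<Rightarrow> ('a \<times> bool \<times> bool) list" where
  "pert k b =
     (bp b, k (bp b), True) # (br b, \<not> k (br b), True) # stair k True (bw b) @
     (bt b, k (bt b), True) # (bq b, \<not> k (bq b), True) # stair k True (bv b) @
     (br b, k (br b), True) # (bp b, \<not> k (bp b), True) # stair k True (bu b) @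
     (bq b, k (bq b), True) # (bt b, \<not> k (bt b), True) # stair k True (bz b)"

text \<open>Covering and distinctness do not depend on the order, so they carry over from the
  undisturbed stair.\<close>

lemma mset_pert: "mset (pert k b) = mset (stair k True (cols b))"
  by (simp add: pert_def cols_def ac_simps)

section \<open>The two new cycles along \<open>C1\<close>\<close>

context crossed_system
begin

fun arc1 :: "'a \<times> bool \<times> bool \<Rightarrow> 'a \<times> bool \<times> bool \<Rightarrow> bool" where
  "arc1 (y, s1, s2) (y', s1', s2') \<longleftrightarrow>
     (s1' = s1 \<and> s2' = s2 \<and> ((y, y') \<in> E1 \<and> s1 = k y' \<or> {y, y'} \<in> Chords)) \<or>
     (y' = y \<and> y \<in> V \<and> y \<notin> Ends \<and> s1' \<noteq> s1 \<and> s2' = s2) \<or>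
     (y = x5 \<and> y' = x5 \<and> s1' \<noteq> s1 \<and> s2' \<noteq> s2)"

text \<open>\<open>arc1\<close> keeps an arc of \<open>C1\<close> in the rows with
  \<open>s1 = k y'\<close>, that is \<open>s1 = (\<not> k y)\<close>, and \<open>arc2\<close> in the
  others. Vertically, \<open>arc2\<close> takes the kind of edge left over at each column.\<close>

fun arc2 :: "'a \<times> bool \<times> bool \<Rightarrow> 'a \<times> bool \<times> bool \<Rightarrow> bool" where
  "arc2 (y, s1, s2) (y', s1', s2') \<longleftrightarrow>
     (if s1 = k y then (y, y') \<in> E1 \<and> s1' = s1 \<and> s2' = s2
      else y' = y \<and> y \<in> V \<and> s1' \<noteq> s1 \<and> (s2' \<noteq> s2 \<longleftrightarrow> y \<notin> D))"

text \<open>One turn along \<open>C1\<close>. The value of \<open>s2\<close> changes exactly once,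
  at \<open>x5\<close>, so that the turn leads from its start to the image of the start under
  \<open>flip2\<close>.\<close>

definition H1 where
  "H1 = stair k False [x0, x1, x2, x3, x4] @ (x5, k x5, False) # (x5, \<not> k x5, True) #
        stair k True Y @ concat (map (pert k) P) @ stair k True (map c L)"

definition H2 where "H2 = weave k (\<lambda>y. y \<notin> D) True C1"

lemma stair_arc1:
  assumes "successively (\<lambda>u v. (u, v) \<in> E1) (y # ys @ [y'])" "set ys \<inter> Ends = {}"
  shows "successively arc1 ((y, \<not> k y, z) # stair k z ys @ [(y', k y', z)])"
  using assms(1)
proof (rule stair_successively)
  show "arc1 (a, \<not> k a, z) (b, k b, z)" if "(a, b) \<in> E1" for a b
    using that E1_simps(1)[OF that] by simp
  have "a \<in> V" if a: "a \<in> set ys" for a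
  proof -
    obtain ys1 ys2 where "ys = ys1 @ a # ys2" using a by (meson split_list)
    with assms(1) have "successively (\<lambda>u v. (u, v) \<in> E1) ((y # ys1) @ [a, hd (ys2 @ [y'])] @ tl (ys2 @ [y']))"
      by (cases ys2) simp_all
    then have "(a, hd (ys2 @ [y'])) \<in> E1" using successively_infix by fastforce
    then show ?thesis using E1_simps(4) by blast
  qed
  then show "arc1 (a, k a, z) (a, \<not> k a, z)" if "a \<in> set ys" for a
    using that assms(2) by auto
qed

text \<open>Induction over the blocks, with \<open>W\<close> the undisturbed columns before the next
  block: the closing segment \<open>bz\<close> of a block is the \<open>W\<close> of the
  rest.\<close>

lemma pert_arc1:
  assumes "successively (\<lambda>u v. (u, v) \<in> E1) (y # W @ concat (map cols Q) @ Z @ [y'])"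
    and "set Q \<subseteq> set P" "set W \<inter> Ends = {}" "set Z \<inter> Ends = {}"
  shows "successively arc1
    ((y, \<not> k y, True) # stair k True W @ concat (map (pert k) Q) @ stair k True Z @ [(y', k y', True)])"
  using assms
proof (induction Q arbitrary: y W)
  case Nil
  then show ?case using stair_arc1[of y "W @ Z" y' True] by auto
next
  case (Cons b Q)
  let ?S = "\<lambda>u v. (u, v) \<in> E1"
  have b: "b \<in> set P" using Cons.prems(2) by simp
  note chord = k_chord[OF b] and out = Ends_block[OF b]
  have "successively ?S (bt b # bz b @ concat (map cols Q) @ Z @ [y'])"
    by (rule successively_infix[of _ "y # W @ bp b # bu b @ bq b # bv b @ br b # bw b" _ "[]"])
      (use Cons.prems(1) in \<open>simp add: cols_def[of b]\<close>)
  then have 5: "successively arc1 ((bt b, \<not> k (bt b), True) # stair k True (bz b) @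
      concat (map (pert k) Q) @ stair k True Z @ [(y', k y', True)])"
    using Cons.prems out by (intro Cons.IH) auto
  have "successively ?S (y # W @ [bp b])"
    by (rule successively_infix[of _ "[]" _ "bu b @ bq b # bv b @ br b # bw b @ bt b # bz b @ concat (map cols Q) @ Z @ [y']"])
      (use Cons.prems(1) in \<open>simp add: cols_def[of b]\<close>)
  from stair_arc1[OF this Cons.prems(3)]
  have 1: "successively arc1 ((y, \<not> k y, True) # stair k True W @ [(bp b, k (bp b), True)])" .
  have "successively ?S (br b # bw b @ [bt b])"
    by (rule successively_infix[of _ "y # W @ bp b # bu b @ bq b # bv b" _ "bz b @ concat (map cols Q) @ Z @ [y']"])
      (use Cons.prems(1) in \<open>simp add: cols_def[of b]\<close>)
  from stair_arc1[OF this out(3)]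
  have 2: "successively arc1 ((br b, \<not> k (br b), True) # stair k True (bw b) @ [(bt b, k (bt b), True)])" .
  have "successively ?S (bq b # bv b @ [br b])"
    by (rule successively_infix[of _ "y # W @ bp b # bu b" _ "bw b @ bt b # bz b @ concat (map cols Q) @ Z @ [y']"])
      (use Cons.prems(1) in \<open>simp add: cols_def[of b]\<close>)
  from stair_arc1[OF this out(2)]
  have 3: "successively arc1 ((bq b, \<not> k (bq b), True) # stair k True (bv b) @ [(br b, k (br b), True)])" .
  have "successively ?S (bp b # bu b @ [bq b])"
    by (rule successively_infix[of _ "y # W" _ "bv b @ br b # bw b @ bt b # bz b @ concat (map cols Q) @ Z @ [y']"])
      (use Cons.prems(1) in \<open>simp add: cols_def[of b]\<close>)
  from stair_arc1[OF this out(1)]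
  have 4: "successively arc1 ((bp b, \<not> k (bp b), True) # stair k True (bu b) @ [(bq b, k (bq b), True)])" .
  have ch: "{bp b, br b} \<in> Chords" "{bq b, bt b} \<in> Chords" "{br b, bp b} \<in> Chords" "{bt b, bq b} \<in> Chords"
    using b unfolding Chords_def by (auto simp: insert_commute)
  have j: "arc1 (bp b, k (bp b), True) (br b, \<not> k (br b), True)"
    "arc1 (bt b, k (bt b), True) (bq b, \<not> k (bq b), True)"
    "arc1 (br b, k (br b), True) (bp b, \<not> k (bp b), True)"
    "arc1 (bq b, k (bq b), True) (bt b, \<not> k (bt b), True)"
    using ch chord by auto
  have join: "successively arc1 (us @ u # v # vs)"
    if "successively arc1 (us @ [u])" "arc1 u v" "successively arc1 (v # vs)" for us u v vs
    using that by (simp add: successively_append_iff)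
  show ?case
    using join[OF 1[unfolded append_Cons[symmetric]] j(1)
        join[OF 2[unfolded append_Cons[symmetric]] j(2)
        join[OF 3[unfolded append_Cons[symmetric]] j(3)
        join[OF 4[unfolded append_Cons[symmetric]] j(4) 5,
          unfolded append_Cons], unfolded append_Cons], unfolded append_Cons]]
    by (simp add: pert_def[of _ b])
qed

lemma H1_arc1: "successively arc1 (H1 @ [flip2 (hd H1)])"
proof -
  let ?S = "\<lambda>u v. (u, v) \<in> E1"
  have C: "C1 @ [x0] = x0 # x1 # x2 # x3 # x4 # x5 # Y @ concat (map cols P) @ map c L @ [x0]"
    unfolding C1_def by (subst (1) L_def) simp
  have "successively ?S (x0 # [x1, x2, x3, x4] @ [x5])"
    by (rule successively_infix[of _ "[]" _ "Y @ concat (map cols P) @ map c L @ [x0]"])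
      (use successively_E1[unfolded C] in simp)
  from stair_arc1[OF this] have 1: "successively arc1
      ((x0, \<not> k x0, False) # stair k False [x1, x2, x3, x4] @ [(x5, k x5, False)])"
    using Ends_rest by auto
  have "successively ?S (x5 # Y @ concat (map cols P) @ map c L @ [x0])"
    by (rule successively_infix[of _ "[x0, x1, x2, x3, x4]" _ "[]"])
      (use successively_E1[unfolded C] in simp)
  from pert_arc1[OF this] have 2: "successively arc1
      ((x5, \<not> k x5, True) # stair k True Y @ concat (map (pert k) P) @ stair k True (map c L) @ [(x0, k x0, True)])"
    using Ends_rest by auto
  have "x0 \<in> V" using L_V by (simp add: L_def)
  then have 0: "arc1 (x0, k x0, False) (x0, \<not> k x0, False)" using Ends_rest(1) by simp
  have g: "arc1 (x5, k x5, False) (x5, \<not> k x5, True)" by simp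
  have "successively arc1 ((x0, k x0, False) #
      ((x0, \<not> k x0, False) # stair k False [x1, x2, x3, x4] @ [(x5, k x5, False)]) @
      ((x5, \<not> k x5, True) # stair k True Y @ concat (map (pert k) P) @ stair k True (map c L) @ [(x0, k x0, True)]))"
    using 0 1 2 g by (simp add: successively_append_iff del: arc1.simps)
  then show ?thesis by (simp add: H1_def del: arc1.simps)
qed

lemma arc1_flip2: "arc1 u v \<Longrightarrow> arc1 (flip2 u) (flip2 v)"
  by (cases u; cases v) auto

lemma arc2_flip2: "arc2 u v \<Longrightarrow> arc2 (flip2 u) (flip2 v)"
  by (cases u; cases v) (auto split: if_splits)

lemma H1_ne: "H1 \<noteq> []" by (simp add: H1_def)

lemma cyc1_arcs: "\<forall>(u, v)\<in>cyc_arcs (H1 @ map flip2 H1). arc1 u v"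
  by (rule half_cycle) (rule H1_ne H1_arc1 flip2_flip2 | erule arc1_flip2)+

lemma proj_stair: "map (\<lambda>(y, a, b). (y, a)) (stair k z ys) = concat (map (\<lambda>y. [(y, k y), (y, \<not> k y)]) ys)"
  by (induction ys) simp_all

lemma columns:
  assumes "mset M = mset (concat (map (\<lambda>y. [(y, f y), (y, \<not> f y)]) C1))"
  shows "distinct M" "set M = V \<times> UNIV"
proof -
  let ?N = "concat (map (\<lambda>y. [(y, f y), (y, \<not> f y)]) C1)"
  have set: "set (concat (map (\<lambda>y. [(y, f y), (y, \<not> f y)]) ys)) = set ys \<times> UNIV" for ys
    by (induction ys) auto
  have "distinct (concat (map (\<lambda>y. [(y, f y), (y, \<not> f y)]) ys))" if "distinct ys" for ys
    using that by (induction ys) (auto simp: set simp del: set_concat)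
  then have "distinct ?N" using ham_C1(1) by blast
  then show "distinct M" using assms mset_eq_imp_distinct_iff by blast
  show "set M = V \<times> UNIV" using assms set[of C1] ham_C1(2) mset_eq_setD by blast
qed

lemma ham_H1:
  "distinct (H1 @ map flip2 H1)" "set (H1 @ map flip2 H1) = V \<times> UNIV"
proof -
  let ?pr = "\<lambda>(y, a, b). (y, a) :: 'a \<times> bool"
  have P: "mset (map ?pr (concat (map (pert k) Q))) = mset (map ?pr (stair k True (concat (map cols Q))))" for Q
  proof (induction Q)
    case (Cons b Q)
    have "mset (map ?pr (pert k b)) = mset (map ?pr (stair k True (cols b)))"
      using mset_pert[of k b] by (simp only: mset_map)
    with Cons show ?case by simp
  qed simp
  have "mset (map ?pr H1) = mset (concat (map (\<lambda>y. [(y, k y), (y, \<not> k y)]) C1))"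
    unfolding H1_def C1_def
    by (subst (2) L_def) (simp add: P proj_stair del: mset_map)
  then have "distinct (map ?pr H1)" "set (map ?pr H1) = V \<times> UNIV" by (rule columns)+
  then show "distinct (H1 @ map flip2 H1)" "set (H1 @ map flip2 H1) = V \<times> UNIV"
    by (rule double_cover)+
qed

lemma ham_H2:
  "distinct (H2 @ map flip2 H2)" "set (H2 @ map flip2 H2) = V \<times> UNIV"
proof -
  have "map (\<lambda>(y, a, b). (y, a)) H2 = concat (map (\<lambda>y. [(y, \<not> k y), (y, \<not> \<not> k y)]) C1)"
    unfolding H2_def proj_weave by simp
  then have "mset (map (\<lambda>(y, a, b). (y, a)) H2) = mset (concat (map (\<lambda>y. [(y, \<not> k y), (y, \<not> \<not> k y)]) C1))"
    by simp
  note columns[OF this]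
  then show "distinct (H2 @ map flip2 H2)" "set (H2 @ map flip2 H2) = V \<times> UNIV"
    by (rule double_cover)+
qed

lemma distinct_P: "distinct P"
proof -
  have "distinct (concat (map cols Q)) \<Longrightarrow> distinct Q" for Q :: "'a block list"
    by (induction Q) (auto simp: cols_def)
  moreover have "distinct (concat (map cols P))" using distinct_L by (simp add: L_def)
  ultimately show ?thesis by blast
qed

text \<open>The ends \<open>br\<close> and \<open>bt\<close> come in pairs, disjoint for distinct
  blocks, and \<open>x5\<close> is one more. This parity makes the weave \<open>H2\<close> arrive at
  its flipped start.\<close>

lemma odd_D: "odd (card D)" "D \<subseteq> V"
proof -
  have fin: "finite (\<Union>b\<in>set P. {br b, bt b})" by auto
  have "card (\<Union>b\<in>set P. {br b, bt b}) = (\<Sum>b\<in>set P. card {br b, bt b})"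
    by (rule card_UN_disjoint) (use ends_disjoint in \<open>auto simp: ends_def\<close>)
  also have "\<dots> = (\<Sum>b\<in>set P. 2)" using ends_distinct by (intro sum.cong) auto
  finally have "even (card (\<Union>b\<in>set P. {br b, bt b}))" by simp
  moreover have "x5 \<notin> (\<Union>b\<in>set P. {br b, bt b})" using ends_distinct by fastforce
  ultimately show "odd (card D)" unfolding D_def using fin by simp
  show "D \<subseteq> V" using Ends_L L_V unfolding D_def Ends_def ends_def by blast
qed

lemma cyc2_arcs: "\<forall>(u, v)\<in>cyc_arcs (H2 @ map flip2 H2). arc2 u v"
proof (rule half_cycle)
  show "arc2 (flip2 u) (flip2 v)" if "arc2 u v" for u v using that by (rule arc2_flip2)
  show "H2 \<noteq> []" by (simp add: H2_def C1_def L_def)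
  have hd: "hd H2 = (x0, \<not> k x0, True)" by (simp add: H2_def C1_def L_def)
  have "successively arc2 (weave k (\<lambda>y. y \<notin> D) True C1 @
      [(x0, \<not> k x0, True \<noteq> odd (length (filter (\<lambda>y. y \<notin> D) C1)))])"
    using successively_E1 
  proof (rule weave_successively)
    show "arc2 (a, k a, z) (b, \<not> k b, z)" if "(a, b) \<in> E1" for a b z
      using E1_simps(1)[OF that] that by simp
    show "arc2 (a, \<not> k a, z) (a, k a, z \<noteq> (a \<notin> D))" if "a \<in> set C1" for a z
      using that ham_C1(2) by auto
  qed
  \<comment> \<open>As \<open>card V\<close> is even and \<open>card D\<close> is odd,
    \<open>s2\<close> is toggled an odd number of times during one turn.\<close>
  moreover have "odd (length (filter (\<lambda>y. y \<notin> D) C1))"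
  proof -
    have "length (filter (\<lambda>y. y \<notin> D) C1) = card (V - D)"
      using distinct_card[OF distinct_filter[OF ham_C1(1), of "\<lambda>y. y \<notin> D"]] ham_C1(2)
      by (simp add: set_diff_eq)
    moreover have "finite D" "finite V" using ham_C1(2) odd_D(2) finite_subset finite_set by metis+
    ultimately have "length (filter (\<lambda>y. y \<notin> D) C1) + card D = card V"
      using odd_D(2) by (simp add: card_Diff_subset card_mono)
    moreover have "even (card V)" using length_C1 by (metis dvd_triv_left)
    ultimately show ?thesis using odd_D(1) by (metis even_add)
  qed
  ultimately show "successively arc2 (H2 @ [flip2 (hd H2)])"
    unfolding hd by (simp add: H2_def)
qed (rule flip2_flip2)

end

section \<open>Disjointness of the new cycles\<close>

text \<open>A fixed choice of the opened cycle, so that the linked cycles become functions of the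
  block.\<close>

definition link_path :: "'a list \<Rightarrow> 'a \<Rightarrow> 'a \<Rightarrow> 'a list" where
  "link_path xs p r = (SOME ys. distinct ys \<and> set ys = set xs \<and> cyc_edges ys = cyc_edges xs \<and>
     hd ys = p \<and> last ys = r \<and> length ys = length xs)"

lemma link_path:
  assumes "distinct xs" "{p, r} \<in> cyc_edges xs"
  shows "distinct (link_path xs p r)" "set (link_path xs p r) = set xs"
    "cyc_edges (link_path xs p r) = cyc_edges xs" "hd (link_path xs p r) = p"
    "last (link_path xs p r) = r" "length (link_path xs p r) = length xs"
proof -
  have "\<exists>ys. distinct ys \<and> set ys = set xs \<and> cyc_edges ys = cyc_edges xs \<and>
     hd ys = p \<and> last ys = r \<and> length ys = length xs"
    by (rule cyc_path_between[OF assms]) blast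
  from someI_ex[OF this]
  show "distinct (link_path xs p r)" "set (link_path xs p r) = set xs"
    "cyc_edges (link_path xs p r) = cyc_edges xs" "hd (link_path xs p r) = p"
    "last (link_path xs p r) = r" "length (link_path xs p r) = length xs"
    unfolding link_path_def by simp_all
qed

lemma link_arc_disjoint:
  assumes "link_arc E p r u v" "E \<inter> E' = {}" "\<And>y. {y} \<notin> E" "\<And>y. {y} \<notin> E'" "{p, r} \<inter> {p', r'} = {}"
  shows "\<not> link_arc E' p' r' u v \<and> \<not> link_arc E' p' r' v u"
  using assms by (cases u; cases v) (auto simp: insert_commute)

lemma cyc_edges_no_singleton: "distinct xs \<Longrightarrow> 2 \<le> length xs \<Longrightarrow> {y} \<notin> cyc_edges xs"
  using cyc_edges_iff[of y y xs] cyc_arcs_irrefl[of xs y] by simp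

context crossed_system
begin

definition A3 where "A3 = pair1 k2 c (hd H) (tl H)"
definition A4 where "A4 = pair2 k2 c (hd H) (tl H)"

abbreviation "arc3 \<equiv> pair_arc1 k2 c (hd H) E2"
abbreviation "arc4 \<equiv> pair_arc2 k2 c (hd H) E2"

lemma H_Cons: "hd H # tl H = H" "H \<noteq> []"
proof -
  show "H \<noteq> []" using length_C2(3) L_ge by auto
  then show "hd H # tl H = H" by simp
qed

lemma hd_H_V: "hd H \<in> V" using ham_C2(2) H_Cons(2) unfolding C2_def by (metis UnI1 hd_in_set set_append)

text \<open>\<open>C2\<close> serves as the antipodal cycle, with \<open>hd H\<close> as the place
  of exchange; \<open>H\<close> has even length, so \<open>tl H\<close> has odd length.\<close>

sublocale pr: antipodal_cycle c "hd H" "tl H" k2 E2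
  rewrites "antipodal_cycle.V c (hd H) (tl H) = V"
proof -
  have s: "successively (\<lambda>u v. (u, v) \<in> E2) (C2 @ [hd C2])"
    using cyc_arcs_all_iff[of C2 "\<lambda>u v. (u, v) \<in> E2"] H_Cons(2) unfolding E2_def C2_def by auto
  have C2: "C2 @ [hd C2] = (hd H # tl H @ [c (hd H)]) @ (map c (tl H) @ [hd H])"
    "C2 @ [hd C2] = (hd H # tl H) @ (c (hd H) # map c (tl H) @ [hd H])"
    unfolding C2_def using H_Cons(2) by (cases H; simp)+
  show a: "antipodal_cycle c (hd H) (tl H) k2 E2"
  proof
    show "c (c y) = y" for y by (rule invol)
    show "distinct ((hd H # tl H) @ map c (hd H # tl H))"
      unfolding H_Cons(1) using ham_C2(1) by (simp only: C2_def)
    have "even (Suc (length (tl H)))" using even_L length_C2(3) H_Cons(1) by (metis length_Cons)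
    then show "odd (length (tl H))" by simp
    show "k2 (c y) = k2 y" if "y \<in> set ((hd H # tl H) @ map c (hd H # tl H))" for y
      using that k2_c ham_C2(2) unfolding H_Cons(1) C2_def by blast
    show "k2 v = (\<not> k2 u)" if "(u, v) \<in> E2" for u v using that by (rule E2_simps(1))
    show "successively (\<lambda>u v. (u, v) \<in> E2) (hd H # tl H @ [c (hd H)])"
      using s[unfolded C2(1)] by (simp only: successively_append_iff)
    show "successively (\<lambda>u v. (u, v) \<in> E2) (c (hd H) # map c (tl H) @ [hd H])"
      using s[unfolded C2(2)] by (simp only: successively_append_iff)
  qed
  show "antipodal_cycle.V c (hd H) (tl H) = V"
    unfolding antipodal_cycle.V_def[OF a] H_Cons(1) using ham_C2(2) by (simp only: C2_def)
qed

lemma ham_A3: "distinct A3" "set A3 = V \<times> UNIV" "\<forall>(u, v)\<in>cyc_arcs A3. arc3 u v"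
  unfolding A3_def by (rule pr.distinct_pair1 pr.set_pair1 pr.pair1_arcs)+

lemma ham_A4: "distinct A4" "set A4 = V \<times> UNIV" "\<forall>(u, v)\<in>cyc_arcs A4. arc4 u v"
  unfolding A4_def by (rule pr.distinct_pair2 pr.set_pair2 pr.pair2_arcs)+

text \<open>This treats the two cycles of a block, each with the ends of its deleted edge,
  uniformly.\<close>

definition strand :: "'a set set \<Rightarrow> 'a \<Rightarrow> 'a \<Rightarrow> bool" where
  "strand E p r \<longleftrightarrow> (\<exists>b\<in>set P. E = cyc_edges (cycA b) \<and> p = bp b \<and> r = br b \<or>
                             E = cyc_edges (cycB b) \<and> p = bq b \<and> r = bt b)"

lemma strandA: "b \<in> set P \<Longrightarrow> strand (cyc_edges (cycA b)) (bp b) (br b)"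
  and strandB: "b \<in> set P \<Longrightarrow> strand (cyc_edges (cycB b)) (bq b) (bt b)"
  unfolding strand_def by auto

lemma strand_E12: "strand E p r \<Longrightarrow> {u, v} \<in> E \<Longrightarrow> (u, v) \<notin> E1 \<and> (u, v) \<notin> E2"
  unfolding strand_def using E1_AB E2_AB by blast

lemma len_AB: "b \<in> set P \<Longrightarrow> 3 \<le> length (cycA b) \<and> 3 \<le> length (cycB b)"
proof -
  assume b: "b \<in> set P"
  have "length (cycA b) = card V" "length (cycB b) = card V"
    using hamA[OF b] hamB[OF b] distinct_card unfolding ham_list_def by metis+
  then show ?thesis using length_C1 L_ge by simp
qed

lemma strand_irrefl: "strand E p r \<Longrightarrow> {y} \<notin> E"
proof -
  have "{y} \<notin> cyc_edges (cycA b)" "{y} \<notin> cyc_edges (cycB b)" if "b \<in> set P" for b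
    using cyc_edges_no_singleton[of "cycA b" y] cyc_edges_no_singleton[of "cycB b" y]
      len_AB[OF that] hamA[OF that] hamB[OF that] unfolding ham_list_def by simp_all
  then show "strand E p r \<Longrightarrow> {y} \<notin> E" unfolding strand_def by blast
qed

text \<open>A linked cycle flips \<open>s1\<close> alone at \<open>p\<close> and both bits at
  \<open>r\<close>. With \<open>p\<close> outside \<open>D\<close> and \<open>r\<close> inside, the
  weave uses the opposite kind at both, and the first cycle has no vertical edge at either.\<close>

lemma strand_ends: "strand E p r \<Longrightarrow> p \<in> Ends - D \<and> r \<in> D \<and> r \<in> Ends \<and> p \<noteq> x5 \<and> r \<noteq> x5 \<and> p \<in> V \<and> r \<in> V"
proof -
  assume "strand E p r"
  then obtain b where b: "b \<in> set P" "p = bp b \<and> r = br b \<or> p = bq b \<and> r = bt b"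
    unfolding strand_def by blast
  have "p \<in> ends b" "r \<in> ends b" using b(2) by (auto simp: ends_def)
  then have "p \<in> Ends" "r \<in> Ends" using b(1) unfolding Ends_def by auto
  moreover from this have "p \<in> V" "r \<in> V" using Ends_L L_V by auto
  moreover have "r \<in> D" using b unfolding D_def by auto
  moreover have ne: "p \<noteq> x5" "r \<noteq> x5" using b ends_distinct[OF b(1)] by auto
  moreover have "p \<notin> D"
  proof
    assume "p \<in> D"
    then obtain b' where b': "b' \<in> set P" "p \<in> {br b', bt b'}" using ne(1) unfolding D_def by blast
    then have "p \<in> ends b'" by (auto simp: ends_def)
    then have "b' = b" using ends_disjoint[OF b'(1) b(1)] \<open>p \<in> ends b\<close> by blast
    then show False using b(2) b'(2) ends_distinct[OF b(1)] by auto
  qed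
  ultimately show ?thesis by blast
qed

text \<open>The cycles of all blocks are edge-disjoint, so the only chord inside a strand is its
  own, which is deleted when the copies are linked.\<close>

lemma strand_chords: "strand E p r \<Longrightarrow> {u, v} \<in> E \<Longrightarrow> {u, v} \<in> Chords \<Longrightarrow> {u, v} = {p, r}"
proof -
  assume s: "strand E p r" and e: "{u, v} \<in> E" "{u, v} \<in> Chords"
  obtain b' where b': "b' \<in> set P" "{u, v} = {bp b', br b'} \<or> {u, v} = {bq b', bt b'}"
    using e(2) unfolding Chords_def by blast
  obtain b where b: "b \<in> set P" "E = cyc_edges (cycA b) \<and> p = bp b \<and> r = br b \<or>
                             E = cyc_edges (cycB b) \<and> p = bq b \<and> r = bt b"
    using s unfolding strand_def by blast
  have "{u, v} \<in> cyc_edges (cycA b') \<union> cyc_edges (cycB b')" using b' chordA chordB by auto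
  moreover have "{u, v} \<in> cyc_edges (cycA b) \<union> cyc_edges (cycB b)" using b e(1) by blast
  ultimately have "b' = b" using disjP[OF b'(1) b(1)] by blast
  then show ?thesis using b b' e(1) disjAB[OF b(1)] chordA[OF b(1)] chordB[OF b(1)] by auto
qed

lemma chord_E12: "{u, v} \<in> Chords \<Longrightarrow> (u, v) \<notin> E1 \<and> (u, v) \<notin> E2 \<and> (v, u) \<notin> E1 \<and> (v, u) \<notin> E2"
  using strand_E12[OF strandA] strand_E12[OF strandB] chordA chordB
  unfolding Chords_def by (auto simp: doubleton_eq_iff insert_commute)

lemma chord_neq: "{u} \<notin> Chords"
  using ends_distinct unfolding Chords_def by fastforce

text \<open>The vertical arcs differ in kind, since \<open>D\<close> decides for both cycles. A copy
  of an arc of \<open>C1\<close> lies in a row \<open>s1 = k y'\<close> for the first cycle and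
  \<open>s1 = k y\<close> for the second, and \<open>k\<close> alternates.\<close>

lemma arc12: "arc1 u v \<Longrightarrow> \<not> arc2 u v \<and> \<not> arc2 v u"
proof -
  have D: "x5 \<in> D" "D \<subseteq> Ends" unfolding D_def Ends_def ends_def by auto
  assume a: "arc1 u v"
  obtain y s1 s2 y' t1 t2 where uv: "u = (y, s1, s2)" "v = (y', t1, t2)" by (cases u; cases v) blast
  show ?thesis
  proof (cases "y' = y")
    case True
    then have "s1 \<noteq> t1" "(t2 \<noteq> s2) \<noteq> (y \<notin> D)"
      using a D chord_neq[of y] E1_simps(3)[of y] unfolding uv by auto
    then show ?thesis using E1_simps(3)[of y] unfolding uv True by auto
  next
    case False
    then have st: "t1 = s1" "t2 = s2" "(y, y') \<in> E1 \<and> s1 = k y' \<or> {y, y'} \<in> Chords"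
      using a unfolding uv by auto
    from st(3) show ?thesis
    proof
      assume e: "(y, y') \<in> E1 \<and> s1 = k y'"
      then have "(y', y) \<notin> E1" "k y' = (\<not> k y)" using E1_simps(1,2) by blast+
      then show ?thesis using e False st(1,2) unfolding uv by auto
    next
      assume "{y, y'} \<in> Chords"
      then have "(y, y') \<notin> E1" "(y', y) \<notin> E1" using chord_E12 by blast+
      then show ?thesis using False unfolding uv by auto
    qed
  qed
qed

lemma x5_V: "x5 \<in> V" using L_V by (simp add: L_def)

text \<open>One reason serves all comparisons of \<open>arc1\<close> and \<open>arc2\<close> with
  \<open>arc3\<close> and \<open>arc4\<close>: the vertical edges of the former change
  \<open>s1\<close> and keep \<open>y\<close>, those of the latter change \<open>s2\<close> alone or
  move to \<open>c y\<close>, and \<open>C2\<close> shares no edge with \<open>C1\<close> or the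
  chords.\<close>

lemma arc13: "arc1 u v \<Longrightarrow> \<not> arc3 u v \<and> \<not> arc3 v u"
proof -
  assume a: "arc1 u v"
  obtain y s1 s2 y' t1 t2 where uv: "u = (y, s1, s2)" "v = (y', t1, t2)" by (cases u; cases v) blast
  show ?thesis
    using a E12[of y y'] E12[of y' y] E1_simps(3)[of y] E2_simps(3)[of y] chord_E12[of y y']
      chord_neq[of y] c_neq[of y] c_neq[of x5] x5_V E1_simps(4)[of y y'] unfolding uv
    by (auto split: if_splits)
qed

lemma arc14: "arc1 u v \<Longrightarrow> \<not> arc4 u v \<and> \<not> arc4 v u"
proof -
  assume a: "arc1 u v"
  obtain y s1 s2 y' t1 t2 where uv: "u = (y, s1, s2)" "v = (y', t1, t2)" by (cases u; cases v) blast
  show ?thesis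
    using a E12[of y y'] E12[of y' y] E1_simps(3)[of y] E2_simps(3)[of y] chord_E12[of y y']
      chord_neq[of y] c_neq[of y] c_neq[of x5] x5_V E1_simps(4)[of y y'] unfolding uv
    by (auto split: if_splits)
qed

lemma arc23: "arc2 u v \<Longrightarrow> \<not> arc3 u v \<and> \<not> arc3 v u"
proof -
  assume a: "arc2 u v"
  obtain y s1 s2 y' t1 t2 where uv: "u = (y, s1, s2)" "v = (y', t1, t2)" by (cases u; cases v) blast
  show ?thesis
    using a E12[of y y'] E12[of y' y] E1_simps(3)[of y] E2_simps(3)[of y] chord_E12[of y y']
      chord_neq[of y] c_neq[of y] c_neq[of x5] x5_V E1_simps(4)[of y y'] unfolding uv
    by (auto split: if_splits)
qed

lemma arc24: "arc2 u v \<Longrightarrow> \<not> arc4 u v \<and> \<not> arc4 v u"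
proof -
  assume a: "arc2 u v"
  obtain y s1 s2 y' t1 t2 where uv: "u = (y, s1, s2)" "v = (y', t1, t2)" by (cases u; cases v) blast
  show ?thesis
    using a E12[of y y'] E12[of y' y] E1_simps(3)[of y] E2_simps(3)[of y] chord_E12[of y y']
      chord_neq[of y] c_neq[of y] c_neq[of x5] x5_V E1_simps(4)[of y y'] unfolding uv
    by (auto split: if_splits)
qed

lemma arc34: "arc3 u v \<Longrightarrow> \<not> arc4 u v \<and> \<not> arc4 v u"
proof -
  assume a: "arc3 u v"
  obtain y s1 s2 y' t1 t2 where uv: "u = (y, s1, s2)" "v = (y', t1, t2)" by (cases u; cases v) blast
  show ?thesis
  proof (cases "(s1 \<noteq> s2) = k2 y")
    case True
    have yV: "y \<in> V" if "swap_rows c (hd H) y s1"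
      using that hd_H_V c_V[of "hd H"] unfolding swap_rows_def by auto
    \<comment> \<open>Both ends of a vertical arc of \<open>arc3\<close> have the same colour and
      the same status under \<open>swap_rows\<close>, so at the far end \<open>arc4\<close> takes
      the other kind of vertical edge.\<close>
    have "k2 y' = k2 y \<and> swap_rows c (hd H) y' t1 = swap_rows c (hd H) y s1"
    proof (cases "swap_rows c (hd H) y s1")
      case sw: True
      then have "y' = c y" "t1 = (\<not> s1)" using a True unfolding uv by auto
      moreover have "swap_rows c (hd H) (c y) (\<not> s1)" using sw invol unfolding swap_rows_def by auto
      ultimately show ?thesis using k2_c[OF yV[OF sw]] sw by simp
    next
      case False
      then show ?thesis using a True unfolding uv by auto
    qed
    then show ?thesis using a True unfolding uv by (auto split: if_splits)
  next
    case False
    then have e: "(y, y') \<in> E2" "t1 = s1" "t2 = s2" using a unfolding uv by auto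
    \<comment> \<open>As \<open>k2\<close> changes along the arc, \<open>arc4\<close> is horizontal
      at \<open>y'\<close>; but there it continues along \<open>C2\<close> and does not go back to
      \<open>y\<close>.\<close>
    then show ?thesis using False E2_simps(1,2)[OF e(1)] E2_simps(3)[of y] unfolding uv
      by (auto split: if_splits)
  qed
qed

lemma arc_strand:
  assumes "strand E p r" "link_arc E p r u v"
  shows "\<not> arc1 u v \<and> \<not> arc1 v u" "\<not> arc2 u v \<and> \<not> arc2 v u"
    "\<not> arc3 u v \<and> \<not> arc3 v u" "\<not> arc4 u v \<and> \<not> arc4 v u"
proof -
  obtain y s1 s2 y' t1 t2 where uv: "u = (y, s1, s2)" "v = (y', t1, t2)" by (cases u; cases v) blast
  note facts = assms(2) strand_E12[OF assms(1), of y y'] strand_E12[OF assms(1), of y' y]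
    strand_irrefl[OF assms(1), of y] strand_ends[OF assms(1)] strand_chords[OF assms(1), of y y']
    E1_simps(3)[of y] E2_simps(3)[of y] c_neq[of p] c_neq[of r] chord_neq[of y]
  have "(\<not> arc1 u v \<and> \<not> arc1 v u) \<and> (\<not> arc2 u v \<and> \<not> arc2 v u)"
  proof (cases "y' = y")
    case True
    then have st: "s1 \<noteq> t1" "y \<noteq> x5" "y \<in> Ends" "(y \<in> D) = (t2 \<noteq> s2)"
      using facts(1,4,5) unfolding uv by auto
    have "\<not> arc1 u v \<and> \<not> arc1 v u"
      using st(1-3) chord_neq[of y] E1_simps(3)[of y] unfolding uv True by auto
    moreover have "\<not> arc2 u v \<and> \<not> arc2 v u"
      using st(1,4) E1_simps(3)[of y] unfolding uv True by auto
    ultimately show ?thesis by blast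
  next
    case False
    then have "(y, y') \<notin> E1" "(y', y) \<notin> E1" "t1 = s1" "t2 = s2" "{y, y'} \<notin> Chords"
      using facts(1-3,6) unfolding uv by (auto simp: insert_commute)
    then show ?thesis unfolding uv using False by (auto simp: insert_commute)
  qed
  then show "\<not> arc1 u v \<and> \<not> arc1 v u" "\<not> arc2 u v \<and> \<not> arc2 v u" by blast+
  have "(\<not> arc3 u v \<and> \<not> arc3 v u) \<and> (\<not> arc4 u v \<and> \<not> arc4 v u)"
  proof (cases "y' = y")
    case True
    then have "s1 \<noteq> t1" "y \<in> V" using facts(1,4,5) unfolding uv by auto
    then show ?thesis using c_neq[of y] E2_simps(3)[of y] unfolding uv True by (auto split: if_splits)
  next
    case False
    then have "(y, y') \<notin> E2" "(y', y) \<notin> E2" "t1 = s1" "t2 = s2"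
      using facts(1-3) unfolding uv by (auto simp: insert_commute)
    then show ?thesis unfolding uv by (auto split: if_splits)
  qed
  then show "\<not> arc3 u v \<and> \<not> arc3 v u" "\<not> arc4 u v \<and> \<not> arc4 v u" by blast+
qed

end

section \<open>Adjacency of the new arcs, and the blocks of the next system\<close>

context crossed_system
begin

lemma Chords_R: "{u, v} \<in> Chords \<Longrightarrow> R u v"
proof -
  assume "{u, v} \<in> Chords"
  then obtain b where b: "b \<in> set P" "{u, v} \<in> cyc_edges (cycA b) \<or> {u, v} \<in> cyc_edges (cycB b)"
    using chordA chordB unfolding Chords_def by auto
  then show ?thesis
    using hamA[OF b(1)] hamB[OF b(1)] sym unfolding ham_list_def cyc_edges_iff by blast
qed

lemma arc1_adj: "arc1 u v \<Longrightarrow> stack_adj R c u v"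
  using ham_C1(3) Chords_R by (cases u; cases v) auto

lemma arc2_adj: "arc2 u v \<Longrightarrow> stack_adj R c u v"
  using ham_C1(3) by (cases u; cases v) (auto split: if_splits)

lemma arc3_adj: "arc3 u v \<Longrightarrow> stack_adj R c u v"
  using ham_C2(3) by (cases u; cases v) (auto split: if_splits)

lemma arc4_adj: "arc4 u v \<Longrightarrow> stack_adj R c u v"
  using ham_C2(3) by (cases u; cases v) (auto split: if_splits)

lemma link_arc_adj: "strand E p r \<Longrightarrow> link_arc E p r u v \<Longrightarrow> stack_adj R c u v"
proof -
  assume s: "strand E p r" and l: "link_arc E p r u v"
  have "R y y'" if e: "{y, y'} \<in> E" for y y'
  proof -
    obtain b where b: "b \<in> set P" "{y, y'} \<in> cyc_edges (cycA b) \<or> {y, y'} \<in> cyc_edges (cycB b)"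
      using s e unfolding strand_def by blast
    then show ?thesis
      using hamA[OF b(1)] hamB[OF b(1)] sym unfolding ham_list_def cyc_edges_iff by blast
  qed
  with l show ?thesis by (cases u; cases v) auto
qed

definition linkA where "linkA b = link (link_path (cycA b) (bp b) (br b))"
definition linkB where "linkB b = link (link_path (cycB b) (bq b) (bt b))"

lemma ham_linkA:
  assumes "b \<in> set P"
  shows "distinct (linkA b)" "set (linkA b) = V \<times> UNIV"
    "\<forall>(u, v)\<in>cyc_arcs (linkA b). link_arc (cyc_edges (cycA b)) (bp b) (br b) u v"
proof -
  have h: "distinct (cycA b)" "set (cycA b) = V" using hamA[OF assms] by (auto simp: ham_list_def)
  note lp = link_path[OF h(1) chordA[OF assms]]
  show "distinct (linkA b)" unfolding linkA_def using lp(1) by (rule distinct_link)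
  show "set (linkA b) = V \<times> UNIV" unfolding linkA_def set_link lp(2) h(2) ..
  show "\<forall>(u, v)\<in>cyc_arcs (linkA b). link_arc (cyc_edges (cycA b)) (bp b) (br b) u v"
    using link_arcs[OF lp(1)] lp(3-6) len_AB[OF assms] unfolding linkA_def by simp
qed

lemma ham_linkB:
  assumes "b \<in> set P"
  shows "distinct (linkB b)" "set (linkB b) = V \<times> UNIV"
    "\<forall>(u, v)\<in>cyc_arcs (linkB b). link_arc (cyc_edges (cycB b)) (bq b) (bt b) u v"
proof -
  have h: "distinct (cycB b)" "set (cycB b) = V" using hamB[OF assms] by (auto simp: ham_list_def)
  note lp = link_path[OF h(1) chordB[OF assms]]
  show "distinct (linkB b)" unfolding linkB_def using lp(1) by (rule distinct_link)
  show "set (linkB b) = V \<times> UNIV" unfolding linkB_def set_link lp(2) h(2) ..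
  show "\<forall>(u, v)\<in>cyc_arcs (linkB b). link_arc (cyc_edges (cycB b)) (bq b) (bt b) u v"
    using link_arcs[OF lp(1)] lp(3-6) len_AB[OF assms] unfolding linkB_def by simp
qed

lemma linkA_edges:
  assumes "b \<in> set P" "{y, y'} \<in> cyc_edges (cycA b)" "{y, y'} \<noteq> {bp b, br b}"
  shows "{(y, s1, s2), (y', s1, s2)} \<in> cyc_edges (linkA b)"
proof -
  have "distinct (cycA b)" using hamA[OF assms(1)] by (simp add: ham_list_def)
  note lp = link_path[OF this chordA[OF assms(1)]]
  show ?thesis unfolding linkA_def using assms(2,3) by (intro link_edges) (simp_all add: lp)
qed

lemma linkB_edges:
  assumes "b \<in> set P" "{y, y'} \<in> cyc_edges (cycB b)" "{y, y'} \<noteq> {bq b, bt b}"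
  shows "{(y, s1, s2), (y', s1, s2)} \<in> cyc_edges (linkB b)"
proof -
  have "distinct (cycB b)" using hamB[OF assms(1)] by (simp add: ham_list_def)
  note lp = link_path[OF this chordB[OF assms(1)]]
  show ?thesis unfolding linkB_def using assms(2,3) by (intro link_edges) (simp_all add: lp)
qed

text \<open>At \<open>(u, k u, z)\<close> the predicate \<open>arc2\<close> forces the outgoing arc
  to follow \<open>C1\<close>. Such edges become the reserved chords of the next system.\<close>

lemma H2_edges:
  assumes "(u, v) \<in> E1" shows "{(u, k u, z), (v, k u, z)} \<in> cyc_edges (H2 @ map flip2 H2)"
proof -
  have "(u, k u, z) \<in> set (H2 @ map flip2 H2)" using ham_H2(2) E1_simps(4)[OF assms] by simp
  then obtain w where w: "((u, k u, z), w) \<in> cyc_arcs (H2 @ map flip2 H2)" by (rule cyc_arcs_out)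
  then have "arc2 (u, k u, z) w" using cyc2_arcs by blast
  then obtain v' where v': "w = (v', k u, z)" "(u, v') \<in> E1" by (cases w) auto
  then have "v' = v" using cyc_arcs_inj[OF ham_C1(1)] assms unfolding E1_def by blast
  then show ?thesis using w v'(1) by (simp add: cyc_edges_iff)
qed

text \<open>The predicate of the cycle concerned is horizontal at \<open>(u, s1, s2)\<close> and so
  forces the outgoing arc. Flipping one bit of the row moves the edge to the other cycle.\<close>

lemma pair_edges:
  assumes "(u, v) \<in> E2"
  shows "{(u, s1, s2), (v, s1, s2)} \<in> (if (s1 \<noteq> s2) = k2 u then cyc_edges A4 else cyc_edges A3)"
proof -
  have uV: "u \<in> V" using E2_simps(4)[OF assms] by simp
  show ?thesis
  proof (cases "(s1 \<noteq> s2) = k2 u")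
    case True
    have "(u, s1, s2) \<in> set A4" using ham_A4(2) uV by simp
    then obtain w where w: "((u, s1, s2), w) \<in> cyc_arcs A4" by (rule cyc_arcs_out)
    then have "arc4 (u, s1, s2) w" using ham_A4(3) by blast
    then obtain v' where v': "w = (v', s1, s2)" "(u, v') \<in> E2" using True by (cases w) auto
    then have "v' = v" using cyc_arcs_inj[OF ham_C2(1)] assms unfolding E2_def by blast
    then show ?thesis using w v'(1) True by (simp add: cyc_edges_iff)
  next
    case False
    have "(u, s1, s2) \<in> set A3" using ham_A3(2) uV by simp
    then obtain w where w: "((u, s1, s2), w) \<in> cyc_arcs A3" by (rule cyc_arcs_out)
    then have "arc3 (u, s1, s2) w" using ham_A3(3) by blast
    then obtain v' where v': "w = (v', s1, s2)" "(u, v') \<in> E2" using False by (cases w) auto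
    then have "v' = v" using cyc_arcs_inj[OF ham_C2(1)] assms unfolding E2_def by blast
    then show ?thesis using w v'(1) False by (simp add: cyc_edges_iff)
  qed
qed

lemma C2_c: "{u, v} \<in> cyc_edges C2 \<Longrightarrow> {c u, c v} \<in> cyc_edges C2"
proof -
  \<comment> \<open>\<open>c\<close> interchanges the two halves of the list, which amounts to a
    rotation.\<close>
  have "map c C2 = rotate (length H) C2"
    by (simp add: C2_def rotate_append invol comp_def)
  then have "cyc_arcs (map c C2) = cyc_arcs C2" by simp
  then have "(c u, c v) \<in> cyc_arcs C2" if "(u, v) \<in> cyc_arcs C2" for u v
    using that unfolding cyc_arcs_map by force
  then show "{u, v} \<in> cyc_edges C2 \<Longrightarrow> {c u, c v} \<in> cyc_edges C2"
    by (auto simp: cyc_edges_iff)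
qed

text \<open>The edge may be traversed in either direction; \<open>f\<close> is the colour of the
  tail of its antipodal copy.\<close>

lemma pair_edges_phase:
  assumes "{u, v} \<in> cyc_edges C2"
  obtains f where "\<And>s1 s2. {(c u, s1, s2), (c v, s1, s2)} \<in> (if (s1 \<noteq> s2) = f then cyc_edges A4 else cyc_edges A3)"
proof -
  have "(c u, c v) \<in> E2 \<or> (c v, c u) \<in> E2"
    using C2_c[OF assms] by (simp add: cyc_edges_iff E2_def)
  then show ?thesis
    using pair_edges[of "c u" "c v"] pair_edges[of "c v" "c u"] that[of "k2 (c u)"] that[of "k2 (c v)"]
    by (auto simp: insert_commute)
qed

lemma k_X: "k x1 = (\<not> k x0)" "k x2 = k x0" "k x3 = (\<not> k x0)" "k x4 = k x0" "k x5 = (\<not> k x0)"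
  "(x0, x1) \<in> E1" "(x1, x2) \<in> E1"
proof -
  have C: "C1 @ [x0] = x0 # x1 # x2 # x3 # x4 # x5 # Y @ concat (map cols P) @ map c L @ [x0]"
    unfolding C1_def by (subst (1) L_def) simp
  have e: "(x0, x1) \<in> E1" "(x1, x2) \<in> E1" "(x2, x3) \<in> E1" "(x3, x4) \<in> E1" "(x4, x5) \<in> E1"
    using successively_E1 unfolding C by simp_all
  then show "(x0, x1) \<in> E1" "(x1, x2) \<in> E1" by simp_all
  show "k x1 = (\<not> k x0)" "k x2 = k x0" "k x3 = (\<not> k x0)" "k x4 = k x0" "k x5 = (\<not> k x0)"
    using e[THEN E1_simps(1)] by simp_all
qed

text \<open>The chords of the new pair are copies of the antipodes of the two reserved edges of
  \<open>C2\<close>, over the half of \<open>C1\<close> that \<open>H1\<close> leaves undisturbed.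
  Flipping \<open>s2\<close> interchanges the two cycles.\<close>

lemma new_block:
  obtains nb where "cols nb = stair k True (map c (x0 # x1 # x2 # x3 # x4 # x5 # Y))"
    "cycA nb = A3 \<and> cycB nb = A4 \<or> cycA nb = A4 \<and> cycB nb = A3"
    "odd (length (bu nb) + length (bv nb))" "odd (length (bv nb) + length (bw nb))"
    "{bp nb, br nb} \<in> cyc_edges (cycA nb)" "{bq nb, bt nb} \<in> cyc_edges (cycB nb)"
    "{flip2 (bp nb), flip2 (br nb)} \<in> cyc_edges (cycB nb)"
    "{flip2 (bq nb), flip2 (bt nb)} \<in> cyc_edges (cycA nb)"
proof -
  have kc: "k (c x0) = k x0" "k (c x1) = (\<not> k x0)" "k (c x2) = k x0" "k (c x3) = (\<not> k x0)"
    "k (c x4) = k x0" "k (c x5) = (\<not> k x0)"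
    using k_X L_V by (simp_all add: k_c L_def)
  let ?a = "k x0"
  obtain f where f: "\<And>s1 s2. {(c x0, s1, s2), (c x3, s1, s2)} \<in>
      (if (s1 \<noteq> s2) = f then cyc_edges A4 else cyc_edges A3)"
    using chord03 pair_edges_phase unfolding C2_def by metis
  obtain g where g: "\<And>s1 s2. {(c x2, s1, s2), (c x5, s1, s2)} \<in>
      (if (s1 \<noteq> s2) = g then cyc_edges A4 else cyc_edges A3)"
    using chord25 pair_edges_phase unfolding C2_def by metis
  \<comment> \<open>\<open>?A\<close> is the cycle that contains the first chord in the row of
    \<open>(c x0, ?a, True)\<close>.\<close>
  let ?A = "if (?a \<noteq> True) = f then A4 else A3" and ?B = "if (?a \<noteq> True) = f then A3 else A4"
  \<comment> \<open>If the phases differ, the second chord lies in the other cycle in the same row;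
    if they agree, its copy with \<open>s1\<close> flipped does. Either copy crosses the first
    chord, with odd distances.\<close>
  define nb where "nb = (if f \<noteq> g
    then Block ?A ?B (c x0, ?a, True) [(c x0, \<not> ?a, True), (c x1, \<not> ?a, True), (c x1, ?a, True)]
      (c x2, ?a, True) [(c x2, \<not> ?a, True), (c x3, \<not> ?a, True)]
      (c x3, ?a, True) [(c x4, ?a, True), (c x4, \<not> ?a, True), (c x5, \<not> ?a, True)]
      (c x5, ?a, True) (stair k True (map c Y))
    else Block ?A ?B (c x0, ?a, True)
      [(c x0, \<not> ?a, True), (c x1, \<not> ?a, True), (c x1, ?a, True), (c x2, ?a, True)]
      (c x2, \<not> ?a, True) [(c x3, \<not> ?a, True)]
      (c x3, ?a, True) [(c x4, ?a, True), (c x4, \<not> ?a, True)]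
      (c x5, \<not> ?a, True) ((c x5, ?a, True) # stair k True (map c Y)))"
  show thesis
  proof (rule that[of nb])
    show "cols nb = stair k True (map c (x0 # x1 # x2 # x3 # x4 # x5 # Y))"
      by (simp add: nb_def cols_def kc)
    show "cycA nb = A3 \<and> cycB nb = A4 \<or> cycA nb = A4 \<and> cycB nb = A3"
      by (simp add: nb_def)
    show "odd (length (bu nb) + length (bv nb))" "odd (length (bv nb) + length (bw nb))"
      by (simp_all add: nb_def)
    show "{bp nb, br nb} \<in> cyc_edges (cycA nb)"
      using f[of ?a True] by (cases f; cases g; cases ?a) (simp_all add: nb_def)
    show "{flip2 (bp nb), flip2 (br nb)} \<in> cyc_edges (cycB nb)"
      using f[of ?a False] by (cases f; cases g; cases ?a) (simp_all add: nb_def)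
    show "{bq nb, bt nb} \<in> cyc_edges (cycB nb)"
      using g[of ?a True] g[of "\<not> ?a" True] by (cases f; cases g; cases ?a) (simp_all add: nb_def)
    show "{flip2 (bq nb), flip2 (bt nb)} \<in> cyc_edges (cycA nb)"
      using g[of ?a False] g[of "\<not> ?a" False] by (cases f; cases g; cases ?a) (simp_all add: nb_def)
  qed
qed

text \<open>The block moves to the antipodal half, where the stair is undisturbed. Each chord runs
  from the entry \<open>en\<close> of one column to the exit \<open>ex\<close> of another, in one
  row by \<open>k_chord\<close>. The flag \<open>w\<close> tells which linked cycle contains the
  antipode of the chord from \<open>bp\<close> to \<open>br\<close>.\<close>

definition lift_block :: "'a block \<Rightarrow> ('a \<times> bool \<times> bool) block" where
  "lift_block b =
     (let w = {c (bp b), c (br b)} \<in> cyc_edges (cycA b) \<and> {c (bq b), c (bt b)} \<in> cyc_edges (cycB b);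
          en = (\<lambda>y. (c y, k (c y), True)); ex = (\<lambda>y. (c y, \<not> k (c y), True))
      in Block (if w then linkA b else linkB b) (if w then linkB b else linkA b)
        (en (bp b)) (ex (bp b) # stair k True (map c (bu b)))
        (en (bq b)) (ex (bq b) # stair k True (map c (bv b)) @ [en (br b)])
        (ex (br b)) (stair k True (map c (bw b)) @ [en (bt b)])
        (ex (bt b)) (stair k True (map c (bz b))))"

lemma cols_lift_block: "cols (lift_block b) = stair k True (map c (cols b))"
  by (simp add: lift_block_def Let_def cols_def)

lemma cyc_lift_block:
  "cycA (lift_block b) = linkA b \<and> cycB (lift_block b) = linkB b \<or>
   cycA (lift_block b) = linkB b \<and> cycB (lift_block b) = linkA b"
  by (simp add: lift_block_def Let_def)

text \<open>Each inner column contributes two vertices, so only the added entries \<open>en\<close>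
  and \<open>ex\<close> affect the parity.\<close>

lemma odd_lift_block:
  "odd (length (bu (lift_block b)) + length (bv (lift_block b)))"
  "odd (length (bv (lift_block b)) + length (bw (lift_block b)))"
  by (simp_all add: lift_block_def Let_def)

text \<open>The antipodal chords have their ends outside \<open>L\<close>, so they differ from the
  deleted edges and survive in every row, in particular for both values of
  \<open>s2\<close>.\<close>

lemma chords_lift_block:
  assumes "b \<in> set P"
  shows "{bp (lift_block b), br (lift_block b)} \<in> cyc_edges (cycA (lift_block b))"
    "{bq (lift_block b), bt (lift_block b)} \<in> cyc_edges (cycB (lift_block b))"
    "{flip2 (bp (lift_block b)), flip2 (br (lift_block b))} \<in> cyc_edges (cycA (lift_block b))"
    "{flip2 (bq (lift_block b)), flip2 (bt (lift_block b))} \<in> cyc_edges (cycB (lift_block b))"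
proof -
  have "ends b \<subseteq> set L" using cols_L(2)[OF assms] ends_cols[of b] by blast
  then have eL: "bp b \<in> set L" "bq b \<in> set L" "br b \<in> set L" "bt b \<in> set L" by (auto simp: ends_def)
  then have ne: "{c (bp b), c (br b)} \<noteq> {bp b, br b}" "{c (bp b), c (br b)} \<noteq> {bq b, bt b}"
    "{c (bq b), c (bt b)} \<noteq> {bp b, br b}" "{c (bq b), c (bt b)} \<noteq> {bq b, bt b}"
    using c_L by (metis insertCI insertE singletonD)+
  have kr: "k (c (br b)) = (\<not> k (c (bp b)))" "k (c (bt b)) = (\<not> k (c (bq b)))"
    using eL L_V k_c k_chord[OF assms] by auto
  show "{bp (lift_block b), br (lift_block b)} \<in> cyc_edges (cycA (lift_block b))"
    "{bq (lift_block b), bt (lift_block b)} \<in> cyc_edges (cycB (lift_block b))"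
    "{flip2 (bp (lift_block b)), flip2 (br (lift_block b))} \<in> cyc_edges (cycA (lift_block b))"
    "{flip2 (bq (lift_block b)), flip2 (bt (lift_block b))} \<in> cyc_edges (cycB (lift_block b))"
    using chordc[OF assms] linkA_edges[OF assms _ ne(1)] linkA_edges[OF assms _ ne(3)]
      linkB_edges[OF assms _ ne(2)] linkB_edges[OF assms _ ne(4)]
    by (auto simp: lift_block_def Let_def kr)
qed

end

section \<open>The induction step\<close>

lemma ham_listI:
  assumes "distinct xs" "set xs = V" "\<forall>(u, v)\<in>cyc_arcs xs. P u v" "\<And>u v. P u v \<Longrightarrow> R u v"
  shows "ham_list V R xs"
  using assms unfolding ham_list_def by auto

context crossed_system
begin

lemma ham_new:
  "ham_list (V \<times> UNIV) (stack_adj R c) (H1 @ map flip2 H1)"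
  "ham_list (V \<times> UNIV) (stack_adj R c) (H2 @ map flip2 H2)"
  "ham_list (V \<times> UNIV) (stack_adj R c) A3"
  "ham_list (V \<times> UNIV) (stack_adj R c) A4"
proof -
  show "ham_list (V \<times> UNIV) (stack_adj R c) (H1 @ map flip2 H1)"
    using ham_H1 cyc1_arcs by (rule ham_listI) (rule arc1_adj)
  show "ham_list (V \<times> UNIV) (stack_adj R c) (H2 @ map flip2 H2)"
    using ham_H2 cyc2_arcs by (rule ham_listI) (rule arc2_adj)
  show "ham_list (V \<times> UNIV) (stack_adj R c) A3"
    using ham_A3 by (rule ham_listI) (rule arc3_adj)
  show "ham_list (V \<times> UNIV) (stack_adj R c) A4"
    using ham_A4 by (rule ham_listI) (rule arc4_adj)
qed

lemma ham_link:
  assumes "b \<in> set P"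
  shows "ham_list (V \<times> UNIV) (stack_adj R c) (linkA b)" "ham_list (V \<times> UNIV) (stack_adj R c) (linkB b)"
proof -
  show "ham_list (V \<times> UNIV) (stack_adj R c) (linkA b)"
    using ham_linkA[OF assms] by (rule ham_listI) (rule link_arc_adj[OF strandA[OF assms]])
  show "ham_list (V \<times> UNIV) (stack_adj R c) (linkB b)"
    using ham_linkB[OF assms] by (rule ham_listI) (rule link_arc_adj[OF strandB[OF assms]])
qed

lemma disj_new:
  "cyc_edges (H1 @ map flip2 H1) \<inter> cyc_edges (H2 @ map flip2 H2) = {}"
  "cyc_edges (H1 @ map flip2 H1) \<inter> cyc_edges A3 = {}"
  "cyc_edges (H1 @ map flip2 H1) \<inter> cyc_edges A4 = {}"
  "cyc_edges (H2 @ map flip2 H2) \<inter> cyc_edges A3 = {}"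
  "cyc_edges (H2 @ map flip2 H2) \<inter> cyc_edges A4 = {}"
  "cyc_edges A3 \<inter> cyc_edges A4 = {}"
  by (rule cyc_edges_disjointI[of _ arc1 _ arc2], rule cyc1_arcs, rule cyc2_arcs, erule arc12)
    (rule cyc_edges_disjointI[of _ arc1 _ arc3], rule cyc1_arcs, rule ham_A3(3), erule arc13,
     rule cyc_edges_disjointI[of _ arc1 _ arc4], rule cyc1_arcs, rule ham_A4(3), erule arc14,
     rule cyc_edges_disjointI[of _ arc2 _ arc3], rule cyc2_arcs, rule ham_A3(3), erule arc23,
     rule cyc_edges_disjointI[of _ arc2 _ arc4], rule cyc2_arcs, rule ham_A4(3), erule arc24,
     rule cyc_edges_disjointI[of _ arc3 _ arc4], rule ham_A3(3), rule ham_A4(3), erule arc34)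

lemma disj_strand:
  assumes "strand E p r" "\<forall>(u, v)\<in>cyc_arcs xs. link_arc E p r u v"
  shows "cyc_edges xs \<inter> cyc_edges (H1 @ map flip2 H1) = {}"
    "cyc_edges xs \<inter> cyc_edges (H2 @ map flip2 H2) = {}"
    "cyc_edges xs \<inter> cyc_edges A3 = {}" "cyc_edges xs \<inter> cyc_edges A4 = {}"
  by (rule cyc_edges_disjointI[of _ "link_arc E p r" _ arc1], rule assms(2), rule cyc1_arcs,
      erule arc_strand[OF assms(1)])
    (rule cyc_edges_disjointI[of _ "link_arc E p r" _ arc2], rule assms(2), rule cyc2_arcs,
      erule arc_strand[OF assms(1)],
     rule cyc_edges_disjointI[of _ "link_arc E p r" _ arc3], rule assms(2), rule ham_A3(3),
      erule arc_strand[OF assms(1)],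
     rule cyc_edges_disjointI[of _ "link_arc E p r" _ arc4], rule assms(2), rule ham_A4(3),
      erule arc_strand[OF assms(1)])

lemma disj_strands:
  assumes "strand E p r" "\<forall>(u, v)\<in>cyc_arcs xs. link_arc E p r u v"
    and "strand E' p' r'" "\<forall>(u, v)\<in>cyc_arcs ys. link_arc E' p' r' u v"
    and "E \<inter> E' = {}" "{p, r} \<inter> {p', r'} = {}"
  shows "cyc_edges xs \<inter> cyc_edges ys = {}"
  by (rule cyc_edges_disjointI[of _ "link_arc E p r" _ "link_arc E' p' r'"], rule assms(2), rule assms(4))
    (erule link_arc_disjoint[OF _ assms(5) strand_irrefl[OF assms(1)] strand_irrefl[OF assms(3)] assms(6)])

lemma disj_linkAB: "b \<in> set P \<Longrightarrow> cyc_edges (linkA b) \<inter> cyc_edges (linkB b) = {}"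
  using ends_distinct[of b]
  by (intro disj_strands[OF strandA ham_linkA(3) strandB ham_linkB(3)] disjAB) auto

lemma disj_link_blocks:
  assumes "b \<in> set P" "b' \<in> set P" "b \<noteq> b'"
  shows "(cyc_edges (linkA b) \<union> cyc_edges (linkB b)) \<inter> (cyc_edges (linkA b') \<union> cyc_edges (linkB b')) = {}"
proof -
  have e: "ends b \<inter> ends b' = {}" using ends_disjoint[OF assms] .
  note d = disjP[OF assms]
  have "cyc_edges (linkA b) \<inter> cyc_edges (linkA b') = {}"
    by (rule disj_strands[OF strandA ham_linkA(3) strandA ham_linkA(3)])
      (use assms d e in \<open>auto simp: ends_def\<close>)
  moreover have "cyc_edges (linkA b) \<inter> cyc_edges (linkB b') = {}"
    by (rule disj_strands[OF strandA ham_linkA(3) strandB ham_linkB(3)])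
      (use assms d e in \<open>auto simp: ends_def\<close>)
  moreover have "cyc_edges (linkB b) \<inter> cyc_edges (linkA b') = {}"
    by (rule disj_strands[OF strandB ham_linkB(3) strandA ham_linkA(3)])
      (use assms d e in \<open>auto simp: ends_def\<close>)
  moreover have "cyc_edges (linkB b) \<inter> cyc_edges (linkB b') = {}"
    by (rule disj_strands[OF strandB ham_linkB(3) strandB ham_linkB(3)])
      (use assms d e in \<open>auto simp: ends_def\<close>)
  ultimately show ?thesis by blast
qed

lemma stack_adj_sym: "stack_adj R c u v \<Longrightarrow> stack_adj R c v u"
  using sym invol by (cases u; cases v) auto

lemma edges_lift_block:
  "cyc_edges (cycA (lift_block b)) \<union> cyc_edges (cycB (lift_block b)) = cyc_edges (linkA b) \<union> cyc_edges (linkB b)"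
  using cyc_lift_block[of b] by auto

theorem stack_crossed_system:
  "\<exists>x0 x1 x2 x3 x4 x5 Y H P'. length P' = Suc (length P) \<and>
     crossed_system (V \<times> UNIV) (stack_adj R c) flip2 x0 x1 x2 x3 x4 x5 Y H P'"
proof -
  obtain nb where cols_nb: "cols nb = stair k True (map c (x0 # x1 # x2 # x3 # x4 # x5 # Y))"
    and cyc_nb: "cycA nb = A3 \<and> cycB nb = A4 \<or> cycA nb = A4 \<and> cycB nb = A3"
    and odd_nb: "odd (length (bu nb) + length (bv nb))" "odd (length (bv nb) + length (bw nb))"
    and chord_nb: "{bp nb, br nb} \<in> cyc_edges (cycA nb)" "{bq nb, bt nb} \<in> cyc_edges (cycB nb)"
      "{flip2 (bp nb), flip2 (br nb)} \<in> cyc_edges (cycB nb)"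
      "{flip2 (bq nb), flip2 (bt nb)} \<in> cyc_edges (cycA nb)"
    by (rule new_block)
  \<comment> \<open>The columns \<open>x0\<close>, \<open>x1\<close>, \<open>x2\<close> with
    \<open>s2 = False\<close> provide the six new reserved vertices; everything disturbed by the old
    blocks goes into \<open>?Y\<close>.\<close>
  let ?Y = "stair k False [x3, x4] @ (x5, k x5, False) # (x5, \<not> k x5, True) # stair k True Y @ concat (map (pert k) P)"
  let ?P = "nb # map lift_block P"
  have cl: "concat (map cols (map lift_block Q)) = stair k True (map c (concat (map cols Q)))" for Q
    by (induction Q) (simp_all add: cols_lift_block)
  have "stair k True (map c L) = stair k True (map c (x0 # x1 # x2 # x3 # x4 # x5 # Y)) @
      stair k True (map c (concat (map cols P)))"
    unfolding L_def by simp
  then have half: "(x0, k x0, False) # (x0, \<not> k x0, False) # (x1, k x1, False) # (x1, \<not> k x1, False) #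
      (x2, k x2, False) # (x2, \<not> k x2, False) # ?Y @ concat (map cols ?P) = H1"
    unfolding H1_def using cl[of P] cols_nb by simp
  have edges_nb: "cyc_edges (cycA nb) \<union> cyc_edges (cycB nb) = cyc_edges A3 \<union> cyc_edges A4"
    using cyc_nb by auto
  have edges: "cyc_edges (cycA b) \<union> cyc_edges (cycB b) \<subseteq> cyc_edges A3 \<union> cyc_edges A4 \<or>
      (\<exists>b'\<in>set P. cyc_edges (cycA b) \<union> cyc_edges (cycB b) \<subseteq> cyc_edges (linkA b') \<union> cyc_edges (linkB b'))"
    if bP: "b \<in> set ?P" for b
  proof -
    consider "b = nb" | b0 where "b0 \<in> set P" "b = lift_block b0" using bP by auto
    then show ?thesis using edges_nb edges_lift_block by cases blast+
  qed
  note dA = disj_strand[OF strandA ham_linkA(3)] and dB = disj_strand[OF strandB ham_linkB(3)]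
  have "crossed_system (V \<times> UNIV) (stack_adj R c) flip2 (x0, k x0, False) (x0, \<not> k x0, False)
      (x1, k x1, False) (x1, \<not> k x1, False) (x2, k x2, False) (x2, \<not> k x2, False) ?Y H2 ?P"
  proof (rule crossed_system.intro, unfold half)
    show "flip2 (flip2 y) = y" for y :: "'a \<times> bool \<times> bool" by (rule flip2_flip2)
    show "stack_adj R c v u" if "stack_adj R c u v" for u v using that by (rule stack_adj_sym)
    show "ham_list (V \<times> UNIV) (stack_adj R c) (H1 @ map flip2 H1)"
      "ham_list (V \<times> UNIV) (stack_adj R c) (H2 @ map flip2 H2)" by (rule ham_new)+
    show "even (length H1)"
    proof -
      have "length (pert k b) = 2 * length (cols b)" for b
        by (simp add: pert_def cols_def)
      then have "even (length (concat (map (pert k) Q)))" for Q by (induction Q) simp_all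
      then show ?thesis unfolding H1_def by simp
    qed
    show "cyc_edges (H1 @ map flip2 H1) \<inter> cyc_edges (H2 @ map flip2 H2) = {}" by (rule disj_new)
    \<comment> \<open>The copy of the arc from \<open>x0\<close> to \<open>x1\<close> that belongs
      to \<open>H2\<close> joins two vertices three places apart on \<open>H1\<close>.\<close>
    show "{(x0, k x0, False), (x1, \<not> k x1, False)} \<in> cyc_edges (H2 @ map flip2 H2)"
      using H2_edges[OF k_X(6), of False] k_X(1) by simp
    show "{(x1, k x1, False), (x2, \<not> k x2, False)} \<in> cyc_edges (H2 @ map flip2 H2)"
      using H2_edges[OF k_X(7), of False] k_X(1,2) by simp
  next
    fix b assume b: "b \<in> set ?P"
    then consider "b = nb" | b0 where "b0 \<in> set P" "b = lift_block b0" by auto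
    note b_cases = this
    show "ham_list (V \<times> UNIV) (stack_adj R c) (cycA b)" "ham_list (V \<times> UNIV) (stack_adj R c) (cycB b)"
      using b_cases cyc_nb cyc_lift_block ham_new ham_link by (metis)+
    show "odd (length (bu b) + length (bv b))" "odd (length (bv b) + length (bw b))"
      using b_cases odd_nb odd_lift_block by metis+
    show "{bp b, br b} \<in> cyc_edges (cycA b)" "{bq b, bt b} \<in> cyc_edges (cycB b)"
      using b_cases chord_nb chords_lift_block by metis+
    show "({flip2 (bp b), flip2 (br b)} \<in> cyc_edges (cycA b) \<and> {flip2 (bq b), flip2 (bt b)} \<in> cyc_edges (cycB b)) \<or>
      ({flip2 (bp b), flip2 (br b)} \<in> cyc_edges (cycB b) \<and> {flip2 (bq b), flip2 (bt b)} \<in> cyc_edges (cycA b))"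
      using b_cases chord_nb chords_lift_block by metis
    show "cyc_edges (cycA b) \<inter> cyc_edges (cycB b) = {}"
      using b_cases disj_new(6) cyc_nb cyc_lift_block disj_linkAB by (metis Int_commute)
    show "(cyc_edges (cycA b) \<union> cyc_edges (cycB b)) \<inter> cyc_edges (H1 @ map flip2 H1) = {}"
      using edges[OF b] disj_new(2,3) dA(1) dB(1) by blast
    show "(cyc_edges (cycA b) \<union> cyc_edges (cycB b)) \<inter> cyc_edges (H2 @ map flip2 H2) = {}"
      using edges[OF b] disj_new(4,5) dA(2) dB(2) by blast
  next
    fix b b' assume b: "b \<in> set ?P" "b' \<in> set ?P" "b \<noteq> b'"
    have nb_l: "(cyc_edges (cycA nb) \<union> cyc_edges (cycB nb)) \<inter>
        (cyc_edges (cycA (lift_block b0)) \<union> cyc_edges (cycB (lift_block b0))) = {}" if "b0 \<in> set P" for b0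
      unfolding edges_nb edges_lift_block using dA(3,4)[OF that that] dB(3,4)[OF that that] by blast
    have ll: "(cyc_edges (cycA (lift_block b0)) \<union> cyc_edges (cycB (lift_block b0))) \<inter>
        (cyc_edges (cycA (lift_block b1)) \<union> cyc_edges (cycB (lift_block b1))) = {}"
      if "b0 \<in> set P" "b1 \<in> set P" "b0 \<noteq> b1" for b0 b1
      unfolding edges_lift_block by (rule disj_link_blocks[OF that])
    consider "b = nb" "b' = nb" | b1 where "b = nb" "b1 \<in> set P" "b' = lift_block b1"
      | b0 where "b' = nb" "b0 \<in> set P" "b = lift_block b0"
      | b0 b1 where "b0 \<in> set P" "b = lift_block b0" "b1 \<in> set P" "b' = lift_block b1"
      using b(1,2) by auto
    then show "(cyc_edges (cycA b) \<union> cyc_edges (cycB b)) \<inter> (cyc_edges (cycA b') \<union> cyc_edges (cycB b')) = {}"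
    proof cases
      case 1 then show ?thesis using b(3) by simp
    next
      case 2 then show ?thesis using nb_l by blast
    next
      case 3 then show ?thesis using nb_l by blast
    next
      case 4 then show ?thesis using ll b(3) by blast
    qed
  qed
  then show ?thesis by (intro exI conjI) (auto)
qed

end

section \<open>Transfer to bit strings\<close>

lemma cyc_edges_map: "cyc_edges (map f xs) = (`) f ` cyc_edges xs"
  unfolding cyc_edges_def cyc_arcs_map image_image by (intro image_cong) auto

lemma ham_list_map:
  assumes "ham_list V R xs" "inj f" "\<And>u v. R u v \<Longrightarrow> R' (f u) (f v)"
  shows "ham_list (f ` V) R' (map f xs)"
  using assms unfolding ham_list_def cyc_arcs_map
  by (auto simp: distinct_map intro: inj_on_subset)

lemma cols_map_block: "cols (map_block f b) = map f (cols b)"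
  by (cases b) (simp add: cols_def)

text \<open>Apart from adjacency, which \<open>f\<close> preserves, the conditions concern only
  equality of vertices and the antipodal map, and \<open>f\<close> is injective and commutes with
  the latter.\<close>

lemma crossed_system_map:
  fixes f :: "'a \<Rightarrow> 'b"
  assumes sys: "crossed_system V R c x0 x1 x2 x3 x4 x5 Y H P"
    and f: "inj f" "\<And>u v. R u v \<Longrightarrow> R' (f u) (f v)" "\<And>u. c' (f u) = f (c u)"
    and c': "\<And>y. c' (c' y) = y" and R': "\<And>u v. R' u v \<Longrightarrow> R' v u"
  shows "crossed_system (f ` V) R' c' (f x0) (f x1) (f x2) (f x3) (f x4) (f x5)
           (map f Y) (map f H) (map (map_block f) P)"
proof -
  interpret crossed_system V R c x0 x1 x2 x3 x4 x5 Y H P by (rule sys)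
  have half: "f x0 # f x1 # f x2 # f x3 # f x4 # f x5 # map f Y @ concat (map cols (map (map_block f) P)) =
      map f (x0 # x1 # x2 # x3 # x4 # x5 # Y @ concat (map cols P))"
    by (simp add: map_concat cols_map_block comp_def)
  have mc: "map c' (map f xs) = map f (map c xs)" for xs
    using f(3) by simp
  have hm: "ham_list V R xs \<Longrightarrow> ham_list (f ` V) R' (map f xs)" for xs
    using ham_list_map[of V R xs f R'] f(1,2) by blast
  have mem: "{f u, f v} \<in> cyc_edges (map f xs) \<longleftrightarrow> {u, v} \<in> cyc_edges xs" for u v xs
  proof -
    have "{f u, f v} = f ` {u, v}" by simp
    moreover have "inj ((`) f)" using f(1) by (simp add: inj_image_eq_iff inj_on_def)
    ultimately show ?thesis unfolding cyc_edges_map by (metis inj_image_mem_iff)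
  qed
  have un: "cyc_edges (map f xs) \<union> cyc_edges (map f ys) = (`) f ` (cyc_edges xs \<union> cyc_edges ys)" for xs ys
    unfolding cyc_edges_map by blast
  have int: "(`) f ` A \<inter> (`) f ` B = {} \<longleftrightarrow> A \<inter> B = {}" for A B
    using f(1) by (auto simp: inj_image_eq_iff)
  note simps = block.map_sel mem f(3)
  show ?thesis
  proof (rule crossed_system.intro, unfold half mc map_append[symmetric] length_map)
    show "c' (c' y) = y" for y by (rule c')
    show "R' v u" if "R' u v" for u v using that by (rule R')
    show "ham_list (f ` V) R' (map f ((x0 # x1 # x2 # x3 # x4 # x5 # Y @ concat (map cols P)) @
        map c (x0 # x1 # x2 # x3 # x4 # x5 # Y @ concat (map cols P))))"
      by (rule hm[OF ham1])
    show "ham_list (f ` V) R' (map f (H @ map c H))"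
      by (rule hm[OF ham2])
    show "even (length (x0 # x1 # x2 # x3 # x4 # x5 # Y @ concat (map cols P)))" by (rule even_half)
    show "cyc_edges (map f ((x0 # x1 # x2 # x3 # x4 # x5 # Y @ concat (map cols P)) @
        map c (x0 # x1 # x2 # x3 # x4 # x5 # Y @ concat (map cols P)))) \<inter> cyc_edges (map f (H @ map c H)) = {}"
      unfolding cyc_edges_map int by (rule disj12)
    show "{f x0, f x3} \<in> cyc_edges (map f (H @ map c H))" unfolding mem by (rule chord03)
    show "{f x2, f x5} \<in> cyc_edges (map f (H @ map c H))" unfolding mem by (rule chord25)
  next
    fix b' assume "b' \<in> set (map (map_block f) P)"
    then obtain b where b: "b \<in> set P" and b': "b' = map_block f b" by auto
    show "ham_list (f ` V) R' (cycA b')" "ham_list (f ` V) R' (cycB b')"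
      unfolding b' block.map_sel
      by (rule hm[OF hamA[OF b]] hm[OF hamB[OF b]])+
    show "odd (length (bu b') + length (bv b'))" "odd (length (bv b') + length (bw b'))"
      unfolding b' block.map_sel length_map by (rule odd_pr[OF b] odd_qt[OF b])+
    show "{bp b', br b'} \<in> cyc_edges (cycA b')" "{bq b', bt b'} \<in> cyc_edges (cycB b')"
      unfolding b' simps by (rule chordA[OF b] chordB[OF b])+
    show "{c' (bp b'), c' (br b')} \<in> cyc_edges (cycA b') \<and> {c' (bq b'), c' (bt b')} \<in> cyc_edges (cycB b') \<or>
      {c' (bp b'), c' (br b')} \<in> cyc_edges (cycB b') \<and> {c' (bq b'), c' (bt b')} \<in> cyc_edges (cycA b')"
      unfolding b' simps by (rule chordc[OF b])
    show "cyc_edges (cycA b') \<inter> cyc_edges (cycB b') = {}"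
      unfolding b' block.map_sel cyc_edges_map int by (rule disjAB[OF b])
    show "(cyc_edges (cycA b') \<union> cyc_edges (cycB b')) \<inter>
        cyc_edges (map f ((x0 # x1 # x2 # x3 # x4 # x5 # Y @ concat (map cols P)) @
        map c (x0 # x1 # x2 # x3 # x4 # x5 # Y @ concat (map cols P)))) = {}"
      unfolding b' block.map_sel un unfolding cyc_edges_map int by (rule disj1[OF b])
    show "(cyc_edges (cycA b') \<union> cyc_edges (cycB b')) \<inter> cyc_edges (map f (H @ map c H)) = {}"
      unfolding b' block.map_sel un unfolding cyc_edges_map int by (rule disj2[OF b])
    fix d' assume "d' \<in> set (map (map_block f) P)" and ne: "b' \<noteq> d'"
    then obtain d where d: "d \<in> set P" and d': "d' = map_block f d" by auto
    have "b \<noteq> d" using ne b' d' by auto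
    then show "(cyc_edges (cycA b') \<union> cyc_edges (cycB b')) \<inter> (cyc_edges (cycA d') \<union> cyc_edges (cycB d')) = {}"
      unfolding b' d' block.map_sel un int by (rule disjP[OF b d])
  qed
qed

text \<open>A recursive form of \<open>aq_adj\<close> that suits induction and evaluation;
  \<open>aq_edge_aq_adj\<close> relates the two.\<close>

fun aq_edge :: "bool list \<Rightarrow> bool list \<Rightarrow> bool" where
  "aq_edge (x # u) (y # v) = (if x = y then aq_edge u v else v = u \<or> v = map Not u)"
| "aq_edge _ _ = False"

lemma map_Not_comp [simp]: "map (Not \<circ> Not) u = u"
  by (simp add: comp_def)

lemma map_Not_Not: "map Not (map Not u) = u"
  by simp

lemma aq_edge_sym: "aq_edge u v \<Longrightarrow> aq_edge v u"
  by (induction u v rule: aq_edge.induct) (auto split: if_splits)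

lemma aq_edge_Not: "aq_edge u v \<Longrightarrow> aq_edge (map Not u) (map Not v)"
  by (induction u v rule: aq_edge.induct) (auto split: if_splits)

text \<open>
  Row flips of \<open>s1\<close>, of \<open>s2\<close>, and of both become the complementations of the last \<open>n + 1\<close> bits, of all
  \<open>n + 2\<close> bits, and of the first bit.
\<close>

fun unstack :: "bool list \<times> bool \<times> bool \<Rightarrow> bool list" where
  "unstack (y, s1, s2) = s2 # (s1 \<noteq> s2) # (if s1 \<noteq> s2 then map Not y else y)"

lemma inj_unstack: "inj unstack"
proof (rule injI)
  fix u v assume "unstack u = unstack v"
  then show "u = v" by (cases u; cases v) (auto split: if_splits dest: arg_cong[of _ _ "map Not"])
qed

lemma unstack_flip2: "map Not (unstack u) = unstack (flip2 u)"
  by (cases u) auto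

text \<open>Edges inside a row are kept because adjacency is invariant under complementation; the
  antipodal edges become changes of the second bit alone.\<close>

lemma unstack_adj: "stack_adj aq_edge (map Not) u v \<Longrightarrow> aq_edge (unstack u) (unstack v)"
  by (cases u; cases v) (auto simp: aq_edge_Not)

lemma unstack_image: "unstack ` ({u. length u = n} \<times> UNIV) = {u. length u = Suc (Suc n)}"
proof
  show "unstack ` ({u. length u = n} \<times> UNIV) \<subseteq> {u. length u = Suc (Suc n)}" by auto
  show "{u. length u = Suc (Suc n)} \<subseteq> unstack ` ({u. length u = n} \<times> UNIV)"
  proof
    fix u :: "bool list" assume "u \<in> {u. length u = Suc (Suc n)}"
    then obtain a b y where "u = a # b # y" "length y = n" by (auto simp: length_Suc_conv)
    then have "u = unstack (if b then map Not y else y, a \<noteq> b, a)" by (cases a; cases b) simp_all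
    then show "u \<in> unstack ` ({u. length u = n} \<times> UNIV)" using \<open>length y = n\<close> by fastforce
  qed
qed

lemma crossed_system_step:
  assumes "crossed_system {u. length u = n} aq_edge (map Not) x0 x1 x2 x3 x4 x5 Y H P"
  shows "\<exists>x0 x1 x2 x3 x4 x5 Y H P'. length P' = Suc (length P) \<and>
     crossed_system {u. length u = Suc (Suc n)} aq_edge (map Not) x0 x1 x2 x3 x4 x5 Y H P'"
proof -
  obtain x0 x1 x2 x3 x4 x5 Y H P' where "length P' = Suc (length P)"
    and sys: "crossed_system ({u. length u = n} \<times> UNIV) (stack_adj aq_edge (map Not)) flip2 x0 x1 x2 x3 x4 x5 Y H P'"
    using crossed_system.stack_crossed_system[OF assms] by blast
  moreover have "crossed_system {u. length u = Suc (Suc n)} aq_edge (map Not) (unstack x0) (unstack x1)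
      (unstack x2) (unstack x3) (unstack x4) (unstack x5) (map unstack Y) (map unstack H)
      (map (map_block unstack) P')"
    unfolding unstack_image[symmetric]
    using sys inj_unstack unstack_adj unstack_flip2 map_Not_Not aq_edge_sym by (rule crossed_system_map)
  ultimately show ?thesis by (metis length_map)
qed

section \<open>The base case\<close>

text \<open>Counting shows that all vertices occur: \<open>2 ^ n\<close> distinct strings of length
  \<open>n\<close> are all of them. What remains can be evaluated.\<close>

lemma ham_list_check:
  assumes "distinct xs" "length xs = 2 ^ n" "list_all (\<lambda>u. length u = n) xs"
    and "list_all (\<lambda>(u, v). aq_edge u v) (zip xs (rotate1 xs))"
  shows "ham_list {u. length u = n} aq_edge xs"
proof -
  have "card {u :: bool list. length u = n} = 2 ^ n"
    using card_lists_length_eq[of "UNIV :: bool set" n] by simp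
  moreover have "finite {u :: bool list. length u = n}"
    using finite_lists_length_eq[of "UNIV :: bool set" n] by simp
  moreover have "set xs \<subseteq> {u. length u = n}" using assms(3) by (auto simp: list_all_iff)
  ultimately have "set xs = {u. length u = n}"
    using assms(1,2) by (intro card_subset_eq) (simp_all add: distinct_card)
  then show ?thesis using assms unfolding ham_list_def cyc_arcs_def list_all_iff by simp
qed

fun no_common_edge :: "('a \<times> 'a) list \<Rightarrow> ('a \<times> 'a) list \<Rightarrow> bool" where
  "no_common_edge [] fs = True"
| "no_common_edge ((u, v) # es) fs \<longleftrightarrow>
     list_all (\<lambda>f. f \<noteq> (u, v) \<and> f \<noteq> (v, u)) fs \<and> no_common_edge es fs"

lemma cyc_edges_disjoint_check:
  assumes "no_common_edge (zip xs (rotate1 xs)) (zip ys (rotate1 ys))"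
  shows "cyc_edges xs \<inter> cyc_edges ys = {}"
proof -
  have "(u, v) \<notin> set fs \<and> (v, u) \<notin> set fs" if "no_common_edge es fs" "(u, v) \<in> set es"
    for u v :: 'a and es fs
    using that by (induction es fs rule: no_common_edge.induct) (auto simp: list_all_iff)
  then show ?thesis
    using assms unfolding cyc_edges_def cyc_arcs_def by (fastforce simp: doubleton_eq_iff)
qed

definition bits5 :: "nat \<Rightarrow> bool list" where
  "bits5 m = map (\<lambda>i. odd (m div 2 ^ i)) [4, 3, 2, 1, 0]"

text \<open>
  The system for \<open>n = 5\<close> arises from the cycles \<open>cyc3a\<close> and \<open>cyc3b\<close> of \<open>AQ\<^sub>3\<close> given below by a variant of the
  induction step in which three columns take over the role of \<open>x5\<close>.
\<close>

definition "base1 = map bits5 [13, 29, 25, 9, 8, 24, 31, 16, 17, 30, 26, 21, 20, 27, 28, 19]"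
definition "base2 = map bits5 [2, 13, 9, 6, 7, 8, 15, 31, 30, 14, 10, 26, 27, 11, 12, 28]"
definition "baseA = map bits5 [31, 0, 2, 10, 9, 1, 3, 11, 15, 7, 5, 13, 14, 6, 4, 12, 8, 23, 21, 29,
  30, 22, 20, 28, 24, 16, 18, 26, 25, 17, 19, 27]"
definition "baseB = map bits5 [0, 8, 10, 21, 22, 9, 11, 20, 16, 15, 13, 18, 17, 14, 12, 19, 23, 31,
  29, 2, 1, 30, 28, 3, 7, 24, 26, 5, 6, 25, 27, 4]"

definition "base_block = Block baseA baseB (bits5 31) (map bits5 [16, 17]) (bits5 30)
  (map bits5 [26, 21, 20]) (bits5 27) [] (bits5 28) [bits5 19]"

lemma base_ham:
  "ham_list {u. length u = 5} aq_edge (base1 @ map (map Not) base1)"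
  "ham_list {u. length u = 5} aq_edge (base2 @ map (map Not) base2)"
  "ham_list {u. length u = 5} aq_edge baseA" "ham_list {u. length u = 5} aq_edge baseB"
  by (rule ham_list_check; code_simp)+

lemma base_disjoint:
  "cyc_edges (base1 @ map (map Not) base1) \<inter> cyc_edges (base2 @ map (map Not) base2) = {}"
  "cyc_edges baseA \<inter> cyc_edges baseB = {}"
  "cyc_edges baseA \<inter> cyc_edges (base1 @ map (map Not) base1) = {}"
  "cyc_edges baseA \<inter> cyc_edges (base2 @ map (map Not) base2) = {}"
  "cyc_edges baseB \<inter> cyc_edges (base1 @ map (map Not) base1) = {}"
  "cyc_edges baseB \<inter> cyc_edges (base2 @ map (map Not) base2) = {}"
  by (rule cyc_edges_disjoint_check; code_simp)+

lemma base_crossed_system: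
  "crossed_system {u. length u = 5} aq_edge (map Not) (bits5 13) (bits5 29) (bits5 25) (bits5 9)
     (bits5 8) (bits5 24) [] base2 [base_block]"
proof -
  have half: "bits5 13 # bits5 29 # bits5 25 # bits5 9 # bits5 8 # bits5 24 # [] @ concat (map cols [base_block]) = base1"
    by (simp add: base_block_def cols_def base1_def)
  note sel = base_block_def block.sel
  have mem: "{u, v} \<in> cyc_edges xs" if "List.member (zip xs (rotate1 xs)) (u, v) \<or> List.member (zip xs (rotate1 xs)) (v, u)"
    for u v :: "bool list" and xs
    using that by (simp add: cyc_edges_iff cyc_arcs_def)
  show ?thesis
  proof (rule crossed_system.intro, unfold half)
    show "map Not (map Not y) = y" for y by (rule map_Not_Not)
    show "aq_edge v u" if "aq_edge u v" for u v using that by (rule aq_edge_sym)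
    show "ham_list {u. length u = 5} aq_edge (base1 @ map (map Not) base1)"
      "ham_list {u. length u = 5} aq_edge (base2 @ map (map Not) base2)"
      by (rule base_ham)+
    show "even (length base1)" by (simp add: base1_def)
    show "cyc_edges (base1 @ map (map Not) base1) \<inter> cyc_edges (base2 @ map (map Not) base2) = {}"
      by (rule base_disjoint)
    show "{bits5 13, bits5 9} \<in> cyc_edges (base2 @ map (map Not) base2)"
      "{bits5 25, bits5 24} \<in> cyc_edges (base2 @ map (map Not) base2)"
      by (rule mem; code_simp)+
  next
    fix b b' assume "b \<in> set [base_block]"
    then have b: "b = base_block" by simp
    show "ham_list {u. length u = 5} aq_edge (cycA b)" "ham_list {u. length u = 5} aq_edge (cycB b)"
      unfolding b sel by (rule base_ham)+
    show "odd (length (bu b) + length (bv b))" "odd (length (bv b) + length (bw b))"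
      unfolding b sel by simp_all
    show "{bp b, br b} \<in> cyc_edges (cycA b)" "{bq b, bt b} \<in> cyc_edges (cycB b)"
      unfolding b sel by (rule mem; code_simp)+
    \<comment> \<open>Here complementation interchanges the two cycles, so the second alternative of
      \<open>chordc\<close> holds.\<close>
    have "{map Not (bp b), map Not (br b)} \<in> cyc_edges (cycB b)"
      "{map Not (bq b), map Not (bt b)} \<in> cyc_edges (cycA b)"
      unfolding b sel by (rule mem; code_simp)+
    then show "{map Not (bp b), map Not (br b)} \<in> cyc_edges (cycA b) \<and>
        {map Not (bq b), map Not (bt b)} \<in> cyc_edges (cycB b) \<or>
        {map Not (bp b), map Not (br b)} \<in> cyc_edges (cycB b) \<and>
        {map Not (bq b), map Not (bt b)} \<in> cyc_edges (cycA b)" by blast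
    show "cyc_edges (cycA b) \<inter> cyc_edges (cycB b) = {}"
      unfolding b sel by (rule base_disjoint)
    show "(cyc_edges (cycA b) \<union> cyc_edges (cycB b)) \<inter> cyc_edges (base1 @ map (map Not) base1) = {}"
      "(cyc_edges (cycA b) \<union> cyc_edges (cycB b)) \<inter> cyc_edges (base2 @ map (map Not) base2) = {}"
      unfolding b sel Int_Un_distrib2 base_disjoint by simp_all
    show "(cyc_edges (cycA b) \<union> cyc_edges (cycB b)) \<inter> (cyc_edges (cycA b') \<union> cyc_edges (cycB b')) = {}"
      if "b' \<in> set [base_block]" "b \<noteq> b'"
      using that b by simp
  qed
qed

lemma crossed_system_odd:
  "\<exists>x0 x1 x2 x3 x4 x5 Y H P. length P = Suc j \<and>
     crossed_system {u. length u = 2 * j + 5} aq_edge (map Not) x0 x1 x2 x3 x4 x5 Y H P"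
proof (induction j)
  case 0
  have "length [base_block] = Suc 0" by simp
  then show ?case using base_crossed_system by (metis add_0 mult_0_right)
next
  case (Suc j)
  then obtain x0 x1 x2 x3 x4 x5 Y H P where P: "length P = Suc j"
    and sys: "crossed_system {u. length u = 2 * j + 5} aq_edge (map Not) x0 x1 x2 x3 x4 x5 Y H P" by blast
  have "2 * Suc j + 5 = Suc (Suc (2 * j + 5))" by simp
  with crossed_system_step[OF sys] P show ?case by metis
qed

section \<open>Disjoint cycles in all dimensions\<close>

lemma sorted_wrt_Cons2:
  assumes "S a b" "\<And>z. z \<in> set zs \<Longrightarrow> S a z \<and> S b z" "sorted_wrt S zs"
  shows "sorted_wrt S (a # b # zs)"
  using assms by simp

text \<open>
  Each cycle comes with an edge \<open>{p, r}\<close> at which its two copies can be joined in the next dimension.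
\<close>

definition disjoint_cycles :: "nat \<Rightarrow> (bool list list \<times> bool list \<times> bool list) list \<Rightarrow> bool" where
  "disjoint_cycles n cs \<longleftrightarrow>
     (\<forall>(xs, p, r)\<in>set cs. ham_list {u. length u = n} aq_edge xs \<and> {p, r} \<in> cyc_edges xs) \<and>
     sorted_wrt (\<lambda>(xs, p, r) (ys, q, t). cyc_edges xs \<inter> cyc_edges ys = {} \<and> {p, r} \<inter> {q, t} = {}) cs"

text \<open>The edges kept for joining copies are one edge each of \<open>C1\<close> and
  \<open>C2\<close> between reserved columns, and the chords of the blocks. They are disjoint
  because all these columns are distinct.\<close>

lemma (in crossed_system) cycles_list:
  fixes cs :: "('a list \<times> 'a \<times> 'a) list"
  defines "cs \<equiv> (C1, x0, x1) # (C2, x2, x5) #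
    concat (map (\<lambda>b. [(cycA b, bp b, br b), (cycB b, bq b, bt b)]) P)"
  shows "length cs = 2 * length P + 2"
    "\<forall>(xs, p, r)\<in>set cs. ham_list V R xs \<and> {p, r} \<in> cyc_edges xs"
    "sorted_wrt (\<lambda>(xs, p, r) (ys, q, t). cyc_edges xs \<inter> cyc_edges ys = {} \<and> {p, r} \<inter> {q, t} = {}) cs"
proof -
  let ?f = "\<lambda>b. [(cycA b, bp b, br b), (cycB b, bq b, bt b)]"
  let ?R = "\<lambda>(xs, p, r) (ys, q, t). cyc_edges xs \<inter> cyc_edges ys = {} \<and> {p, r} \<inter> {q, t} = ({} :: 'a set)"
  have "length (concat (map ?f Q)) = 2 * length Q" for Q by (induction Q) simp_all
  then show "length cs = 2 * length P + 2" unfolding cs_def by simp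
  have h: "ham_list V R C1" "ham_list V R C2"
    using ham1 ham2 unfolding C1_def C2_def L_def by simp_all
  have e: "{x0, x1} \<in> cyc_edges C1" "{x2, x5} \<in> cyc_edges C2"
    using k_X(6) chord25 unfolding E1_def C2_def by (simp_all add: cyc_edges_iff)
  show "\<forall>(xs, p, r)\<in>set cs. ham_list V R xs \<and> {p, r} \<in> cyc_edges xs"
    unfolding cs_def using h e hamA hamB chordA chordB by auto
  have s: "sorted_wrt ?R (concat (map ?f Q))" if "distinct Q" "set Q \<subseteq> set P" for Q
    using that
  proof (induction Q)
    case (Cons b Q)
    then have b: "b \<in> set P" by simp
    have 1: "?R (cycA b, bp b, br b) (cycB b, bq b, bt b)"
      using disjAB[OF b] ends_distinct[OF b] by auto
    have 2: "?R z z'" if z: "z \<in> set (?f b)" and z': "z' \<in> set (concat (map ?f Q))" for z z'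
    proof -
      obtain b' where b': "b' \<in> set Q" "z' \<in> set (?f b')" using z' by auto
      then have "b' \<in> set P" "b \<noteq> b'" using Cons.prems by auto
      then show ?thesis using z b'(2) disjP[OF b] ends_disjoint[OF b] unfolding ends_def by auto
    qed
    have "sorted_wrt ?R (concat (map ?f Q))" using Cons by simp
    then have "sorted_wrt ?R ((cycA b, bp b, br b) # (cycB b, bq b, bt b) # concat (map ?f Q))"
      by (rule sorted_wrt_Cons2[where S = ?R, OF 1, rotated]) (intro conjI 2, simp_all)
    then show ?case by simp
  qed simp
  have d: "?R (C1, x0, x1) (C2, x2, x5)"
    using disj12 distinct_L unfolding C1_def C2_def L_def by auto
  have x: "{x0, x1} \<inter> ends b = {}" "{x2, x5} \<inter> ends b = {}" if "b \<in> set P" for b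
    using cols_L(3)[OF that] ends_cols[of b] by auto
  have f: "?R (C1, x0, x1) z \<and> ?R (C2, x2, x5) z" if z: "z \<in> set (concat (map ?f P))" for z
  proof -
    obtain b where b: "b \<in> set P" "z \<in> set (?f b)" using z by auto
    then show ?thesis
      using disj1[OF b(1)] disj2[OF b(1)] x[OF b(1)] unfolding C1_def C2_def L_def ends_def by auto
  qed
  show "sorted_wrt ?R cs"
    unfolding cs_def by (rule sorted_wrt_Cons2, rule d, rule f, assumption, rule s[OF distinct_P subset_refl])
qed

lemma (in crossed_system) ex_cycles_list:
  "\<exists>cs. length cs = 2 * length P + 2 \<and>
     (\<forall>(xs, p, r)\<in>set cs. ham_list V R xs \<and> {p, r} \<in> cyc_edges xs) \<and>
     sorted_wrt (\<lambda>(xs, p, r) (ys, q, t). cyc_edges xs \<inter> cyc_edges ys = {} \<and> {p, r} \<inter> {q, t} = {}) cs"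
  by (intro exI conjI) (rule cycles_list)+

lemma disjoint_cycles_odd: "\<exists>cs. length cs = 2 * j + 4 \<and> disjoint_cycles (2 * j + 5) cs"
proof -
  obtain x0 x1 x2 x3 x4 x5 Y H P where P: "length P = Suc j"
    and sys: "crossed_system {u. length u = 2 * j + 5} aq_edge (map Not) x0 x1 x2 x3 x4 x5 Y H P"
    using crossed_system_odd[of j] by blast
  have len: "2 * length P + 2 = 2 * j + 4" using P by simp
  show ?thesis
    using crossed_system.ex_cycles_list[OF sys] unfolding disjoint_cycles_def len .
qed

definition cyc3a :: "bool list list" where
  "cyc3a = [[False, False, False], [False, False, True], [True, False, True], [True, False, False],
    [False, True, True], [False, True, False], [True, True, False], [True, True, True]]"
definition cyc3b :: "bool list list" where
  "cyc3b = [[False, False, False], [False, True, False], [False, False, True], [False, True, True],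
    [True, True, True], [True, False, True], [True, True, False], [True, False, False]]"

text \<open>The crossed systems start in dimension 5, so dimension 3 is checked directly.\<close>

lemma disjoint_cycles_3: 
  "disjoint_cycles 3 [(cyc3a, [False, False, False], [False, False, True]), (cyc3b, [True, True, True], [True, False, True])]"
proof -
  have "ham_list {u. length u = 3} aq_edge cyc3a" "ham_list {u. length u = 3} aq_edge cyc3b"
    by (rule ham_list_check; code_simp)+
  moreover have "cyc_edges cyc3a \<inter> cyc_edges cyc3b = {}"
    by (rule cyc_edges_disjoint_check) code_simp
  moreover have "{[False, False, False], [False, False, True]} \<in> cyc_edges cyc3a"
    "{[True, True, True], [True, False, True]} \<in> cyc_edges cyc3b"
    unfolding cyc_edges_iff cyc_arcs_def cyc3a_def cyc3b_def by simp_all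
  ultimately show ?thesis unfolding disjoint_cycles_def by simp
qed

lemma disjoint_cycles_exist:
  assumes "odd n" "3 \<le> n" shows "\<exists>cs. length cs = n - 1 \<and> disjoint_cycles n cs"
proof (cases "n = 3")
  case True
  then show ?thesis using disjoint_cycles_3 by (intro exI conjI) auto
next
  case False
  have "\<exists>j. n = 2 * j + 5" using assms False by presburger
  then obtain j where "n = 2 * j + 5" by blast
  moreover from this have "n - 1 = 2 * j + 4" by simp
  ultimately show ?thesis using disjoint_cycles_odd[of j] by metis
qed

section \<open>From odd to even dimension\<close>

definition double :: "bool list list \<Rightarrow> bool list list" where
  "double q = map (Cons False) q @ map (Cons True) (rev q)"

fun double_arc :: "bool list set set \<Rightarrow> bool list \<Rightarrow> bool list \<Rightarrow> bool list \<Rightarrow> bool list \<Rightarrow> bool" where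
  "double_arc E p r (a # u) (b # v) \<longleftrightarrow>
     (b = a \<and> {u, v} \<in> E) \<or> (b \<noteq> a \<and> v = u \<and> u \<in> {p, r})"
| "double_arc E p r _ _ = False"

text \<open>The edge between \<open>p\<close> and \<open>r\<close> is deleted in both copies: at
  \<open>r\<close> the path passes to the second copy, which it traverses backwards, and at
  \<open>p\<close> it returns.\<close>

lemma ham_double:
  assumes "ham_list {u. length u = n} aq_edge xs" "{p, r} \<in> cyc_edges xs"
  defines "q \<equiv> link_path xs p r"
  shows "ham_list {u. length u = Suc n} aq_edge (double q)"
    "\<forall>(u, v)\<in>cyc_arcs (double q). double_arc (cyc_edges xs) p r u v"
proof -
  have dist: "distinct xs" and set: "set xs = {u. length u = n}" using assms(1) by (auto simp: ham_list_def)
  note lp = link_path[OF dist assms(2), folded q_def]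
  have ne: "q \<noteq> []" using lp(6) assms(2) by (auto simp: cyc_edges_def cyc_arcs_def)
  have S: "successively (\<lambda>u v. {u, v} \<in> cyc_edges q) q"
    unfolding successively_iff_infix
  proof (intro allI impI)
    fix l1 u v l2 assume "q = l1 @ u # v # l2"
    then show "{u, v} \<in> cyc_edges q" using infix_cyc_arcs[of u v l1 l2] by (simp add: cyc_edges_iff)
  qed
  then have S': "successively (\<lambda>u v. {u, v} \<in> cyc_edges q) (rev q)"
    by (simp add: successively_rev insert_commute)
  have "successively (double_arc (cyc_edges xs) p r) (double q @ [hd (double q)])"
    unfolding double_def using ne S S' lp(3-5)
    by (simp add: successively_append_iff successively_map hd_map last_map hd_rev last_rev)
  then show arcs: "\<forall>(u, v)\<in>cyc_arcs (double q). double_arc (cyc_edges xs) p r u v"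
    using ne by (intro cyc_arcs_all_iff[THEN iffD2]) (simp_all add: double_def)
  have adj: "aq_edge u v" if "{u, v} \<in> cyc_edges xs" for u v
    using that assms(1) aq_edge_sym unfolding cyc_edges_iff ham_list_def by blast
  have "distinct (double q)" using lp(1) by (auto simp: double_def distinct_map)
  moreover have "set (double q) = {u. length u = Suc n}"
  proof -
    have "set (double q) = Cons False ` {u. length u = n} \<union> Cons True ` {u. length u = n}"
      by (simp add: double_def lp(2) set)
    also have "\<dots> = {u. length u = Suc n}"
      by (auto simp: length_Suc_conv image_iff) 
    finally show ?thesis .
  qed
  moreover have "aq_edge u v" if "double_arc (cyc_edges xs) p r u v" for u v
    using that adj by (cases u; cases v) auto
  ultimately show "ham_list {u. length u = Suc n} aq_edge (double q)"
    using arcs by (intro ham_listI)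
qed

lemma disjoint_double:
  assumes "\<forall>(u, v)\<in>cyc_arcs xs. double_arc E p r u v" "\<forall>(u, v)\<in>cyc_arcs ys. double_arc F q t u v"
    and "E \<inter> F = {}" "{p, r} \<inter> {q, t} = {}"
  shows "cyc_edges xs \<inter> cyc_edges ys = {}"
proof (rule cyc_edges_disjointI[OF assms(1,2)])
  fix u v assume "double_arc E p r u v"
  then show "\<not> double_arc F q t u v \<and> \<not> double_arc F q t v u"
    using assms(3,4) by (cases u; cases v) (auto simp: insert_commute)
qed

section \<open>Comparison with the defining adjacency\<close>

lemma aq_edge_split:
  "aq_edge u v \<Longrightarrow> \<exists>w x z. u = w @ x # z \<and> (v = w @ (\<not> x) # z \<or> v = w @ (\<not> x) # map Not z)"
proof (induction u v rule: aq_edge.induct)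
  case (1 x u y v)
  show ?case
  proof (cases "x = y")
    case True
    then obtain w a z where "u = w @ a # z" "v = w @ (\<not> a) # z \<or> v = w @ (\<not> a) # map Not z"
      using 1 by auto
    then show ?thesis using True by (intro exI[of _ "y # w"] exI[of _ a] exI[of _ z]) auto
  next
    case False
    then show ?thesis using 1(2) by (intro exI[of _ "[]"] exI[of _ x] exI[of _ u]) auto
  qed
qed simp_all

lemma aq_edge_aq_adj:
  assumes "aq_edge u v" "length u = n" shows "aq_adj n u v"
proof -
  obtain w x z where u: "u = w @ x # z" and v: "v = w @ (\<not> x) # z \<or> v = w @ (\<not> x) # map Not z"
    using aq_edge_split[OF assms(1)] by blast
  \<comment> \<open>Positions are counted from the right, so the first difference, which
    \<open>z\<close> follows, has position \<open>Suc (length z)\<close>.\<close>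
  let ?j = "Suc (length z)"
  have n: "n = length w + ?j" and lv: "length v = n" using assms(2) u v by auto
  have high: "bit_at v l = bit_at u l" if "?j < l" "l \<le> n" for l
    using that u v unfolding bit_at_def lv assms(2) by (auto simp: nth_append n)
  have mid: "bit_at v ?j \<noteq> bit_at u ?j"
    using u v unfolding bit_at_def lv assms(2) by (auto simp: nth_append n)
  show ?thesis
  proof (cases "v = w @ (\<not> x) # z")
    case True
    have low: "bit_at v l = bit_at u l" if "1 \<le> l" "l < ?j" for l
    proof -
      have "n - l = length w + Suc (length z - l)" using that n by auto
      then show ?thesis using u True unfolding bit_at_def lv assms(2) by (simp add: nth_append)
    qed
    have "\<exists>!i. i \<in> {1..n} \<and> bit_at u i \<noteq> bit_at v i"
    proof (rule ex1I[of _ ?j])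
      show "?j \<in> {1..n} \<and> bit_at u ?j \<noteq> bit_at v ?j" using mid n by auto
      show "i = ?j" if "i \<in> {1..n} \<and> bit_at u i \<noteq> bit_at v i" for i
        using that low[of i] high[of i] by (metis atLeastAtMost_iff linorder_neqE_nat)
    qed
    then show ?thesis unfolding aq_adj_def by blast
  next
    case False
    \<comment> \<open>For empty \<open>z\<close> the two alternatives coincide. Hence
      \<open>z\<close> is nonempty and \<open>?j\<close> is at least 2, as the suffix edges
      require.\<close>
    then have v': "v = w @ (\<not> x) # map Not z" and "z \<noteq> []" using v by auto
    have low: "bit_at v l \<noteq> bit_at u l" if "1 \<le> l" "l \<le> ?j" for l
    proof (cases "l = ?j")
      case True
      then show ?thesis using mid by simp
    next
      case False
      then have "n - l = length w + Suc (length z - l)" "length z - l < length z" using that n by auto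
      then show ?thesis using u v' unfolding bit_at_def lv assms(2) by (simp add: nth_append)
    qed
    have "?j \<in> {2..n}" using \<open>z \<noteq> []\<close> n by (cases z) auto
    moreover have "\<forall>l\<in>{1..?j}. bit_at v l \<noteq> bit_at u l" using low by simp
    moreover have "\<forall>l\<in>{?j<..n}. bit_at v l = bit_at u l" using high by simp
    ultimately show ?thesis unfolding aq_adj_def by blast
  qed
qed

section \<open>Cyclic lists as Hamiltonian cycles of the digraph\<close>

definition cycle_walk :: "'a list \<Rightarrow> ('a \<times> 'a) list" where
  "cycle_walk xs = zip xs (rotate1 xs)"

lemma undirected_edges_cycle_walk: "undirected_edges (cycle_walk xs) = cyc_edges xs"
  by (simp add: undirected_edges_def cycle_walk_def cyc_edges_def cyc_arcs_def)

lemma cas_zip: "pre_digraph.cas (with_proj G) x (zip (x # ys) (ys @ [z])) z"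
  by (induction ys arbitrary: x) (simp_all add: pre_digraph.cas.simps)

lemma awalk_verts_zip:
  "pre_digraph.awalk_verts (with_proj G) x (zip (x # ys) (ys @ [z])) = x # ys @ [z]"
  by (induction ys arbitrary: x) (simp_all add: pre_digraph.awalk_verts.simps)

lemma hamiltonian_cycle_walk:
  assumes "ham_list {u. length u = n} aq_edge xs" "2 \<le> n"
  shows "hamiltonian_cycle (augmented_cube n) (cycle_walk xs)"
proof -
  have dist: "distinct xs" and set: "set xs = {u. length u = n}"
    and arcs: "\<And>u v. (u, v) \<in> cyc_arcs xs \<Longrightarrow> aq_edge u v"
    using assms(1) by (auto simp: ham_list_def)
  have "card {u :: bool list. length u = n} = 2 ^ n"
    using card_lists_length_eq[of "UNIV :: bool set" n] by simp
  then have len: "length xs = 2 ^ n" using distinct_card[OF dist] set by simp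
  have "(2 :: nat) ^ 2 \<le> 2 ^ n" using assms(2) by (intro power_increasing) auto
  then have len4: "4 \<le> length xs" using len by simp
  then obtain x ys where xs: "xs = x # ys" by (cases xs) auto
  have walk: "cycle_walk xs = zip (x # ys) (ys @ [x])" by (simp add: cycle_walk_def xs)
  have "set (cycle_walk xs) \<subseteq> parcs (augmented_cube n)"
  proof
    fix e assume "e \<in> set (cycle_walk xs)"
    moreover obtain u v where "e = (u, v)" by (cases e)
    ultimately have e: "e = (u, v)" "(u, v) \<in> cyc_arcs xs"
      by (simp_all only: cycle_walk_def cyc_arcs_def)
    then show "e \<in> parcs (augmented_cube n)"
      using cyc_arcs_setD[OF e(2)] arcs[OF e(2)] set aq_edge_aq_adj by (simp add: augmented_cube_def)
  qed
  moreover have "x \<in> pverts (augmented_cube n)" using set xs by (auto simp: augmented_cube_def)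
  ultimately have "pre_digraph.awalk (with_proj (augmented_cube n)) x (cycle_walk xs) x"
    unfolding pre_digraph.awalk_def using cas_zip[of "augmented_cube n" x ys x] by (simp add: walk)
  moreover have "distinct (tl (pre_digraph.awalk_verts (with_proj (augmented_cube n)) x (cycle_walk xs)))"
    unfolding walk awalk_verts_zip using dist xs by auto
  moreover have "cycle_walk xs \<noteq> []" by (simp add: walk)
  ultimately have "pre_digraph.cycle (with_proj (augmented_cube n)) (cycle_walk xs)"
    unfolding pre_digraph.cycle_def by blast
  moreover have "3 \<le> length (cycle_walk xs)" using len4 by (simp add: cycle_walk_def)
  moreover have "fst ` set (cycle_walk xs) = pverts (augmented_cube n)"
  proof -
    have "map fst (cycle_walk xs) = xs" by (simp add: cycle_walk_def)
    then show ?thesis using set by (simp add: augmented_cube_def flip: set_map)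
  qed
  ultimately show ?thesis unfolding hamiltonian_cycle_def by simp
qed

lemma disjoint_walks:
  assumes "\<forall>xs\<in>set cs. ham_list {u. length u = n} aq_edge xs" "2 \<le> n"
    and "sorted_wrt (\<lambda>xs ys. cyc_edges xs \<inter> cyc_edges ys = {}) cs"
  shows "\<exists>C. card C = length cs \<and> (\<forall>p\<in>C. hamiltonian_cycle (augmented_cube n) p) \<and> pairwise edge_disjoint C"
proof -
  let ?ws = "map cycle_walk cs"
  have ham: "\<forall>p\<in>set ?ws. hamiltonian_cycle (augmented_cube n) p"
    using assms(1,2) hamiltonian_cycle_walk by auto
  have sorted: "sorted_wrt edge_disjoint ?ws"
    using assms(3) unfolding sorted_wrt_map edge_disjoint_def undirected_edges_cycle_walk .
  \<comment> \<open>A walk with an edge is not edge-disjoint from itself. So the walks are distinct,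
    and their set has as many elements as the list.\<close>
  have ne: "undirected_edges p \<noteq> {}" if "p \<in> set ?ws" for p
  proof -
    have "p \<noteq> []" using ham that unfolding hamiltonian_cycle_def by force
    then show ?thesis by (auto simp: undirected_edges_def)
  qed
  have "distinct ws \<and> pairwise edge_disjoint (set ws)"
    if "sorted_wrt edge_disjoint ws" "\<And>p. p \<in> set ws \<Longrightarrow> undirected_edges p \<noteq> {}"
    for ws :: "(bool list \<times> bool list) list list"
    using that
  proof (induction ws)
    case (Cons w ws)
    then have w: "\<forall>p\<in>set ws. edge_disjoint w p" "undirected_edges w \<noteq> {}" by simp_all
    then have "w \<notin> set ws" by (auto simp: edge_disjoint_def)
    moreover have "edge_disjoint p w" if "p \<in> set ws" for p
      using w(1) that by (simp add: edge_disjoint_def Int_commute)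
    ultimately show ?case using Cons w(1) by (auto simp: pairwise_insert)
  qed simp
  from this[OF sorted ne] have "distinct ?ws \<and> pairwise edge_disjoint (set ?ws)" .
  moreover from this have "card (set ?ws) = length cs" using distinct_card[of ?ws] by simp
  ultimately show ?thesis using ham by blast
qed

theorem theorem4p1:
  fixes n :: nat
  assumes "n \<ge> 3"
  shows "\<exists>C. card C = (if odd n then n - 1 else n - 2) \<and>
             (\<forall>p\<in>C. hamiltonian_cycle (augmented_cube n) p) \<and>
             pairwise edge_disjoint C"
proof (cases "odd n")
  case True
  then obtain cs where len: "length cs = n - 1" and cs: "disjoint_cycles n cs"
    using disjoint_cycles_exist assms by blast
  have "\<forall>xs\<in>set (map fst cs). ham_list {u. length u = n} aq_edge xs"
    using cs unfolding disjoint_cycles_def by auto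
  moreover have "sorted_wrt (\<lambda>xs ys. cyc_edges xs \<inter> cyc_edges ys = {}) (map fst cs)"
    unfolding sorted_wrt_map
    by (rule sorted_wrt_mono_rel[OF _ cs[unfolded disjoint_cycles_def, THEN conjunct2]]) auto
  ultimately show ?thesis using disjoint_walks[of "map fst cs" n] assms True len by simp
next
  case False
  \<comment> \<open>The \<open>m - 1 = n - 2\<close> cycles of the odd dimension below are
    doubled.\<close>
  define m where "m = n - 1"
  have m: "odd m" "3 \<le> m" "n = Suc m" using False assms unfolding m_def by presburger+
  obtain cs where len: "length cs = m - 1" and cs: "disjoint_cycles m cs"
    using disjoint_cycles_exist[OF m(1,2)] by blast
  let ?f = "\<lambda>(xs, p, r). double (link_path xs p r)"
  have ham: "ham_list {u. length u = m} aq_edge xs" "{p, r} \<in> cyc_edges xs" if "(xs, p, r) \<in> set cs" for xs p r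
    using cs that unfolding disjoint_cycles_def by auto
  have "\<forall>xs\<in>set (map ?f cs). ham_list {u. length u = n} aq_edge xs"
    using ham_double(1)[OF ham] unfolding m(3) by auto
  moreover have "sorted_wrt (\<lambda>xs ys. cyc_edges xs \<inter> cyc_edges ys = {}) (map ?f cs)"
    unfolding sorted_wrt_map
  proof (rule sorted_wrt_mono_rel[OF _ cs[unfolded disjoint_cycles_def, THEN conjunct2]])
    fix a b
    assume "a \<in> set cs" "b \<in> set cs"
      and ab: "(\<lambda>(xs, p, r) (ys, q, t). cyc_edges xs \<inter> cyc_edges ys = {} \<and> {p, r} \<inter> {q, t} = {}) a b"
    moreover obtain xs p r ys q t where eq: "a = (xs, p, r)" "b = (ys, q, t)"
      by (cases a; cases b) blast
    ultimately have x: "(xs, p, r) \<in> set cs" and y: "(ys, q, t) \<in> set cs"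
      and d: "cyc_edges xs \<inter> cyc_edges ys = {}" "{p, r} \<inter> {q, t} = {}" by auto
    show "cyc_edges (?f a) \<inter> cyc_edges (?f b) = {}"
      unfolding eq prod.case
      by (rule disjoint_double[where E = "cyc_edges xs" and p = p and r = r and F = "cyc_edges ys" and q = q and t = t])
        (rule ham_double(2)[OF ham[OF x]], rule ham_double(2)[OF ham[OF y]], rule d, rule d)
  qed
  ultimately show ?thesis using disjoint_walks[of "map ?f cs" n] assms False len m(3) by simp
qed

end
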